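(* Let $X$ be a countable topological group whose topology is sequential. Then the following are equivalent: (1) the topology of $X$ is analytic; (2) the topology of $X$ is $F_{\sigma\delta}$; (3) $X$ is either first countable or a $k_\omega$-space.
   Context: All topological spaces are assumed to be regular (including Hausdorff). The topology of a countable space $X$ is regarded as a subset of $2^X$ (subsets of $X$ identified with characteristic functions) with the product topology. The topology is called analytic if it is an analytic subset of $2^X$, i.e. a continuous image of the irrationals $\mathbb{N}^\omega$; it is called $F_{\sigma\delta}$ if it is an $F_{\sigma\delta}$ subset of $2^X$. A space $X$ is sequential if whenever $A\subseteq X$ and $\overline{A}\setminus A\neq\varnothing$, there is a sequence of points of $A$ converging to some $x\in\overline{A}\setminus A$. A space $X$ is a $k_\omega$-space if there is a family $\{K_n : n\in\omega\}$ of compact subsets of $X$ such that a set $U\subseteq X$ is open if and only if $U\cap K_n$ is relatively open in $K_n$ for every $n\in\omega$. *)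

theory Defs
  imports "HOL-Analysis.Analysis" "HOL-Library.Countable"
begin

definition sequential_space :: "'a topology \<Rightarrow> bool" where
  "sequential_space X \<longleftrightarrow>
     (\<forall>A. A \<subseteq> topspace X \<and> X closure_of A - A \<noteq> {} \<longrightarrow>
        (\<exists>s :: nat \<Rightarrow> 'a. range s \<subseteq> A \<and>
           (\<exists>x \<in> X closure_of A - A. limitin X s x sequentially)))"

definition k_omega_space :: "'a topology \<Rightarrow> bool" where
  "k_omega_space X \<longleftrightarrow>
     (\<exists>K :: nat \<Rightarrow> 'a set. (\<forall>n. compactin X (K n)) \<and>
        (\<forall>U. U \<subseteq> topspace X \<longrightarrow>
           (openin X U \<longleftrightarrow> (\<forall>n. openin (subtopology X (K n)) (U \<inter> K n)))))"

text \<open>The Baire space of irrationals is the type \<^typ>\<open>nat \<Rightarrow> nat\<close> with its product topology.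
  In this literal form the empty set is not analytic; this is immaterial for topologies,
  which are never empty.\<close>

definition analytic_set :: "'b::topological_space set \<Rightarrow> bool" where
  "analytic_set S \<longleftrightarrow> (\<exists>f :: (nat \<Rightarrow> nat) \<Rightarrow> 'b. continuous_on UNIV f \<and> range f = S)"

definition fsigma_delta :: "'b::topological_space set \<Rightarrow> bool" where
  "fsigma_delta S \<longleftrightarrow> (\<exists>F :: nat \<Rightarrow> 'b set. (\<forall>n. fsigma (F n)) \<and> S = (\<Inter>n. F n))"

text \<open>The type \<^typ>\<open>'a \<Rightarrow> bool\<close> carries the product of the discrete topologies on
  \<^typ>\<open>bool\<close>, so it is the space of characteristic functions \<open>2\<^sup>X\<close> when
  \<open>topspace X = UNIV\<close>; otherwise \<open>2\<^sup>X\<close> is identified with the closed subspace of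
  functions that are false off \<open>topspace X\<close>, which affects neither notion below.\<close>

definition open_set_indicators :: "'a topology \<Rightarrow> ('a \<Rightarrow> bool) set" where
  "open_set_indicators X = {c. openin X {x. c x}}"

definition analytic_topology :: "'a topology \<Rightarrow> bool" where
  "analytic_topology X \<longleftrightarrow> analytic_set (open_set_indicators X)"

definition fsigma_delta_topology :: "'a topology \<Rightarrow> bool" where
  "fsigma_delta_topology X \<longleftrightarrow> fsigma_delta (open_set_indicators X)"

end

theory Submission
  imports Defs
begin

text \<open>
  Let \<open>g\<close> be a continuous map of the Baire space onto the open neighbourhoods of \<open>0\<close>. For a
  property \<open>P\<close> of sets, either countably many sets with \<open>P\<close> suffice to place one inside every
  neighbourhood, or there is a nonempty closed \<open>K\<close> such that \<open>P\<close> fails for the intersection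
  of \<open>g\<close> over every relative cylinder of \<open>K\<close>. In the second case, by a Baire category
  argument, every sequence converging to \<open>0\<close> is eventually in one of these countably many
  intersections.

  Apply this to \<open>P N\<close> = ``the closure of \<open>- N + N\<close> is a sequential neighbourhood of \<open>0\<close>''
  (the first alternative gives first countability) and to \<open>P N\<close> = ``the closure of
  \<open>N \<inter> V\<close> is noncompact for all neighbourhoods \<open>V\<close>'' (the second alternative gives
  countably many compact sets capturing all sequences converging to \<open>0\<close>, hence a
  \<open>k\<^sub>\<omega>\<close>-space). In the remaining case there are countably many sets \<open>N j\<close>, one inside each
  neighbourhood, whose closures contain locally finite sequences \<open>x j\<close>, arbitrarily near \<open>0\<close>.
  Perturb \<open>x j\<close> by a null sequence so as to leave the first \<open>j\<close> intersections of the first kernel.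
  The union of the perturbed sequences is then sequentially closed: a sequence running through
  infinitely many \<open>j\<close> and converging to \<open>0\<close> would eventually be in one of the intersections
  it avoids. But \<open>0\<close> is in its closure, a contradiction.
\<close>

subsection \<open>The Baire space\<close>

text \<open>The basic clopen sets, indexed by a point and a length instead of a finite word, so that
  cylinders around points of a closed set can be named directly.\<close>

definition cyl :: "(nat \<Rightarrow> nat) \<Rightarrow> nat \<Rightarrow> (nat \<Rightarrow> nat) set" where
  "cyl \<alpha> n = {\<beta>. \<forall>i<n. \<beta> i = \<alpha> i}"

lemma cyl_self [simp]: "\<alpha> \<in> cyl \<alpha> n"
  by (simp add: cyl_def)

lemma cyl_eq: "\<beta> \<in> cyl \<alpha> n \<Longrightarrow> cyl \<beta> n = cyl \<alpha> n"
  by (auto simp: cyl_def)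

lemma cyl_mono: "m \<le> n \<Longrightarrow> cyl \<alpha> n \<subseteq> cyl \<alpha> m"
  by (auto simp: cyl_def)

lemma cyl_trans: "\<beta> \<in> cyl \<alpha> m \<Longrightarrow> m \<le> n \<Longrightarrow> cyl \<beta> n \<subseteq> cyl \<alpha> m"
  by (auto simp: cyl_def)

text \<open>A cylinder depends only on the finite word of the first \<open>n\<close> values of
  \<open>\<alpha>\<close>. This keeps the families of cores countable.\<close>

lemma countable_cylinders: "countable (range (\<lambda>(\<alpha>, n). cyl \<alpha> n))"
proof -
  have "range (\<lambda>(\<alpha>, n). cyl \<alpha> n) \<subseteq> range (\<lambda>s :: nat list. {\<beta>. \<forall>i<length s. \<beta> i = s ! i})"
  proof clarify
    fix \<alpha> :: "nat \<Rightarrow> nat" and n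
    have "cyl \<alpha> n = {\<beta>. \<forall>i<length (map \<alpha> [0..<n]). \<beta> i = map \<alpha> [0..<n] ! i}"
      by (auto simp: cyl_def)
    then show "cyl \<alpha> n \<in> range (\<lambda>s :: nat list. {\<beta>. \<forall>i<length s. \<beta> i = s ! i})"
      by blast
  qed
  then show ?thesis
    by (rule countable_subset) simp
qed

lemma open_cyl: "open (cyl \<alpha> n)"
proof -
  have "open (\<Inter>i\<in>{..<n}. {\<beta> :: nat \<Rightarrow> nat. \<beta> i = \<alpha> i})"
  proof (intro open_INT ballI)
    fix i
    have "continuous_on UNIV (\<lambda>\<beta> :: nat \<Rightarrow> nat. \<beta> i)"
      by (rule continuous_on_product_coordinates)
    then have "open ((\<lambda>\<beta> :: nat \<Rightarrow> nat. \<beta> i) -` {\<alpha> i})"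
      by (rule open_vimage[rotated]) (rule open_discrete)
    then show "open {\<beta> :: nat \<Rightarrow> nat. \<beta> i = \<alpha> i}"
      by (simp add: vimage_def)
  qed simp
  also have "(\<Inter>i\<in>{..<n}. {\<beta> :: nat \<Rightarrow> nat. \<beta> i = \<alpha> i}) = cyl \<alpha> n"
    by (auto simp: cyl_def)
  finally show ?thesis .
qed

lemma open_contains_cyl:
  assumes "open U" "\<alpha> \<in> U"
  shows "\<exists>n. cyl \<alpha> n \<subseteq> U"
proof -
  have "openin (product_topology (\<lambda>i. euclidean) UNIV) U"
    using assms by (simp add: open_fun_def)
  from product_topology_open_contains_basis[OF this assms(2)]
  obtain X where X: "\<alpha> \<in> (\<Pi>\<^sub>E i\<in>UNIV. X i)" "finite {i. X i \<noteq> (UNIV :: nat set)}"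
      "(\<Pi>\<^sub>E i\<in>UNIV. X i) \<subseteq> U"
    by auto
  from X(2) obtain n where n: "\<And>i. X i \<noteq> UNIV \<Longrightarrow> i < n"
    using finite_nat_set_iff_bounded by auto
  have "cyl \<alpha> n \<subseteq> (\<Pi>\<^sub>E i\<in>UNIV. X i)"
    using X(1) n by (force simp: cyl_def PiE_iff)
  then show ?thesis
    using X(3) by blast
qed

lemma continuous_Baire_iff:
  fixes f :: "(nat \<Rightarrow> nat) \<Rightarrow> 'b \<Rightarrow> 'c::discrete_topology"
  shows "continuous_on UNIV f \<longleftrightarrow> (\<forall>\<alpha> x. \<exists>n. \<forall>\<beta>\<in>cyl \<alpha> n. f \<beta> x = f \<alpha> x)"
proof safe
  fix \<alpha> x
  assume "continuous_on UNIV f"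
  then have "continuous_on UNIV (\<lambda>\<alpha>. f \<alpha> x)"
    by (rule continuous_on_product_then_coordinatewise)
  then have "open ((\<lambda>\<alpha>. f \<alpha> x) -` {f \<alpha> x})"
    by (rule open_vimage[rotated]) (rule open_discrete)
  from open_contains_cyl[OF this, of \<alpha>]
  show "\<exists>n. \<forall>\<beta>\<in>cyl \<alpha> n. f \<beta> x = f \<alpha> x"
    by auto
next
  assume *: "\<forall>\<alpha> x. \<exists>n. \<forall>\<beta>\<in>cyl \<alpha> n. f \<beta> x = f \<alpha> x"
  show "continuous_on UNIV f"
  proof (rule continuous_on_coordinatewise_then_product)
    fix x
    have "open ((\<lambda>\<alpha>. f \<alpha> x) -` B)" for B
    proof (rule Topological_Spaces.openI)
      fix \<alpha> assume a: "\<alpha> \<in> (\<lambda>\<alpha>. f \<alpha> x) -` B"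
      obtain n where n: "\<forall>\<beta>\<in>cyl \<alpha> n. f \<beta> x = f \<alpha> x"
        using * by blast
      have "cyl \<alpha> n \<subseteq> (\<lambda>\<alpha>. f \<alpha> x) -` B"
      proof
        fix \<beta> assume "\<beta> \<in> cyl \<alpha> n"
        with n have "f \<beta> x = f \<alpha> x" by blast
        with a show "\<beta> \<in> (\<lambda>\<alpha>. f \<alpha> x) -` B" by simp
      qed
      then show "\<exists>T. open T \<and> \<alpha> \<in> T \<and> T \<subseteq> (\<lambda>\<alpha>. f \<alpha> x) -` B"
        by (intro exI[of _ "cyl \<alpha> n"]) (simp add: open_cyl)
    qed
    then show "continuous_on UNIV (\<lambda>\<alpha>. f \<alpha> x)"
      unfolding continuous_on_open_vimage[OF open_UNIV] by simp
  qed
qed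

text \<open>A point outside \<open>E\<close> is sent to a point of \<open>E\<close> chosen from the smallest cylinder
  around it that still meets \<open>E\<close>.\<close>

lemma closed_Baire_retract:
  fixes E :: "(nat \<Rightarrow> nat) set"
  assumes "closed E" "E \<noteq> {}"
  shows "\<exists>r :: (nat \<Rightarrow> nat) \<Rightarrow> nat \<Rightarrow> nat. continuous_on UNIV r \<and> range r = E"
proof -
  define c where "c S = (SOME \<beta>. \<beta> \<in> E \<inter> S)" for S
  have c: "c S \<in> E \<inter> S" if "E \<inter> S \<noteq> {}" for S
    using someI_ex[of "\<lambda>\<beta>. \<beta> \<in> E \<inter> S"] that unfolding c_def by blast
  \<comment> \<open>Testing length \<open>Suc n\<close> makes \<open>m \<alpha>\<close>, for
    \<open>\<alpha>\<close> outside \<open>E\<close>, the greatest length at which the cylinder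
    meets \<open>E\<close>: length 0 gives the whole space and \<open>E\<close> is nonempty.\<close>
  define m where "m \<alpha> = (LEAST n. E \<inter> cyl \<alpha> (Suc n) = {})" for \<alpha>
  define r where "r \<alpha> = (if \<alpha> \<in> E then \<alpha> else c (cyl \<alpha> (m \<alpha>)))" for \<alpha>
  have ex: "\<exists>n. E \<inter> cyl \<alpha> (Suc n) = {}" if nE: "\<alpha> \<notin> E" for \<alpha>
  proof -
    have "open (- E)"
      using assms by auto
    then obtain n where "cyl \<alpha> n \<subseteq> - E"
      using open_contains_cyl[of "- E" \<alpha>] nE by blast
    then have "E \<inter> cyl \<alpha> (Suc n) = {}"
      using cyl_mono[of n "Suc n" \<alpha>] by auto
    then show ?thesis ..
  qed
  have m0: "E \<inter> cyl \<alpha> (Suc (m \<alpha>)) = {}" if "\<alpha> \<notin> E" for \<alpha>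
    unfolding m_def by (rule LeastI_ex) (rule ex[OF that])
  have m1: "E \<inter> cyl \<alpha> (m \<alpha>) \<noteq> {}" for \<alpha>
  proof (cases "m \<alpha>")
    case 0
    then show ?thesis using assms(2) by (simp add: cyl_def)
  next
    case (Suc k)
    then have "k < m \<alpha>" by simp
    then have "\<not> E \<inter> cyl \<alpha> (Suc k) = {}"
      unfolding m_def by (rule not_less_Least)
    then show ?thesis using Suc by simp
  qed
  have mge: "n \<le> m \<alpha>" if "E \<inter> cyl \<alpha> n \<noteq> {}" "\<alpha> \<notin> E" for \<alpha> n
  proof (rule ccontr)
    assume "\<not> n \<le> m \<alpha>"
    then have "cyl \<alpha> n \<subseteq> cyl \<alpha> (Suc (m \<alpha>))"
      by (intro cyl_mono) simp
    then show False
      using that(1) m0[OF that(2)] by blast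
  qed
  have rE: "r \<alpha> \<in> E" for \<alpha>
    using c[OF m1] by (auto simp: r_def)
  have cont: "\<exists>n. \<forall>\<beta>\<in>cyl \<alpha> n. r \<beta> i = r \<alpha> i" for \<alpha> i
  proof (cases "\<alpha> \<in> E")
    case True
    \<comment> \<open>Continuity at a point of \<open>E\<close>: the cylinder of length
      \<open>Suc i\<close> around \<open>\<beta>\<close> contains \<open>\<alpha>\<close> and so
      meets \<open>E\<close>; hence \<open>r \<beta>\<close> keeps at least the first
      \<open>Suc i\<close> values of \<open>\<beta>\<close>.\<close>
    have "r \<beta> i = r \<alpha> i" if b: "\<beta> \<in> cyl \<alpha> (Suc i)" for \<beta>
    proof (cases "\<beta> \<in> E")
      case True
      then show ?thesis using \<open>\<alpha> \<in> E\<close> b by (simp add: r_def cyl_def)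
    next
      case False
      have "Suc i \<le> m \<beta>"
        using True False cyl_eq[OF b] by (intro mge) auto
      moreover have "r \<beta> \<in> cyl \<beta> (m \<beta>)"
        using c[OF m1] False by (auto simp: r_def)
      ultimately show ?thesis
        using \<open>\<alpha> \<in> E\<close> b by (simp add: r_def cyl_def)
    qed
    then show ?thesis by blast
  next
    case False
    have *: "r \<beta> = r \<alpha>" if b: "\<beta> \<in> cyl \<alpha> (Suc (m \<alpha>))" for \<beta>
    proof -
      have nb: "\<beta> \<notin> E"
        using m0[OF False] b by auto
      have "m \<beta> \<le> m \<alpha>"
        using m0[OF False] cyl_eq[OF b] unfolding m_def[of \<beta>] by (intro Least_le) simp
      moreover have e: "cyl \<beta> (m \<alpha>) = cyl \<alpha> (m \<alpha>)"
        using b by (intro cyl_eq) (auto simp: cyl_def)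
      then have "m \<alpha> \<le> m \<beta>"
        using m1[of \<alpha>] nb by (intro mge) auto
      ultimately show ?thesis
        using e nb False by (simp add: r_def)
    qed
    show ?thesis
      by (intro exI[of _ "Suc (m \<alpha>)"] ballI fun_cong[OF *])
  qed
  have "continuous_on UNIV r"
    unfolding continuous_Baire_iff using cont by blast
  moreover have "range r = E"
  proof
    show "E \<subseteq> range r"
    proof
      fix \<alpha> assume "\<alpha> \<in> E"
      then have "r \<alpha> = \<alpha>" by (simp add: r_def)
      then show "\<alpha> \<in> range r" using rangeI[of r \<alpha>] by simp
    qed
  qed (use rE in blast)
  ultimately show ?thesis by blast
qed

section \<open>F_sigma_delta sets as continuous images of the Baire space\<close>

text \<open>The pairs of a point \<open>d\<close> and a function \<open>h\<close> with
  \<open>d \<in> C n (h n)\<close> for all \<open>n\<close> form a closed set, coded as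
  \<open>E\<close> in the Baire space. It projects onto \<open>S\<close>, and
  \<open>closed_Baire_retract\<close> makes it a continuous image of the Baire space.\<close>

lemma fsigma_delta_imp_analytic:
  fixes S :: "('a::countable \<Rightarrow> bool) set"
  assumes "fsigma_delta S" "S \<noteq> {}"
  shows "analytic_set S"
proof -
  obtain F :: "nat \<Rightarrow> ('a \<Rightarrow> bool) set" where F: "\<And>n. fsigma (F n)" "S = (\<Inter>n. F n)"
    using assms(1) unfolding fsigma_delta_def by blast
  have "\<exists>C :: nat \<Rightarrow> ('a \<Rightarrow> bool) set. (\<forall>m. closed (C m)) \<and> F n = (\<Union>m. C m)" for n
    using F(1)[of n] by cases auto
  then obtain C :: "nat \<Rightarrow> nat \<Rightarrow> ('a \<Rightarrow> bool) set"
    where C: "\<And>n m. closed (C n m)" "\<And>n. F n = (\<Union>m. C n m)"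
    by metis
  \<comment> \<open>Even coordinates code a characteristic function, 0 standing for
    \<open>True\<close>; odd coordinates carry the witness \<open>h\<close>.\<close>
  define c :: "(nat \<Rightarrow> nat) \<Rightarrow> 'a \<Rightarrow> bool" where "c \<alpha> x \<longleftrightarrow> \<alpha> (2 * to_nat x) = 0" for \<alpha> x
  define E where "E = (\<Inter>n. \<Union>m. {\<alpha>. c \<alpha> \<in> C n m \<and> \<alpha> (2 * n + 1) = m})"
  have cc: "continuous_on UNIV c"
    unfolding continuous_Baire_iff
  proof safe
    fix \<alpha> x
    show "\<exists>n. \<forall>\<beta>\<in>cyl \<alpha> n. c \<beta> x = c \<alpha> x"
      by (rule exI[of _ "Suc (2 * to_nat x)"]) (simp add: c_def cyl_def)
  qed
  have "closed E"
    unfolding E_def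
  proof (intro closed_INT ballI)
    fix n
    have "open (- (\<Union>m. {\<alpha>. c \<alpha> \<in> C n m \<and> \<alpha> (2 * n + 1) = m}))"
    proof (rule Topological_Spaces.openI)
      fix \<alpha> assume a: "\<alpha> \<in> - (\<Union>m. {\<alpha>. c \<alpha> \<in> C n m \<and> \<alpha> (2 * n + 1) = m})"
      let ?m = "\<alpha> (2 * n + 1)"
      have "open (c -` (- C n ?m))"
        using cc C(1) by (intro open_vimage open_Compl)
      moreover have "\<alpha> \<in> c -` (- C n ?m)"
        using a by auto
      ultimately obtain k where "cyl \<alpha> k \<subseteq> c -` (- C n ?m)"
        using open_contains_cyl by blast
      then have "cyl \<alpha> k \<inter> cyl \<alpha> (2 * n + 2) \<subseteq> - (\<Union>m. {\<alpha>. c \<alpha> \<in> C n m \<and> \<alpha> (2 * n + 1) = m})"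
        by (auto simp: cyl_def)
      then show "\<exists>T. open T \<and> \<alpha> \<in> T \<and> T \<subseteq> - (\<Union>m. {\<alpha>. c \<alpha> \<in> C n m \<and> \<alpha> (2 * n + 1) = m})"
        by (intro exI[of _ "cyl \<alpha> k \<inter> cyl \<alpha> (2 * n + 2)"]) (simp add: open_cyl open_Int)
    qed
    then show "closed (\<Union>m. {\<alpha>. c \<alpha> \<in> C n m \<and> \<alpha> (2 * n + 1) = m})"
      by (simp add: closed_def)
  qed
  moreover have im: "c ` E = S"
  proof safe
    fix \<alpha> assume "\<alpha> \<in> E"
    then show "c \<alpha> \<in> S"
      by (auto simp: E_def F(2) C(2))
  next
    fix d assume "d \<in> S"
    then have "\<forall>n. \<exists>m. d \<in> C n m"
      by (auto simp: F(2) C(2))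
    then obtain h where h: "\<And>n. d \<in> C n (h n)" by metis
    define \<alpha> where "\<alpha> k = (if even k then of_bool (\<not> d (from_nat (k div 2))) else h (k div 2))" for k
    have "c \<alpha> = d"
      by (auto simp: fun_eq_iff c_def \<alpha>_def)
    moreover from this have "\<alpha> \<in> E"
      using h by (auto simp: E_def \<alpha>_def)
    ultimately show "d \<in> c ` E" by blast
  qed
  moreover from im have "E \<noteq> {}"
    using assms(2) by auto
  ultimately obtain r :: "(nat \<Rightarrow> nat) \<Rightarrow> nat \<Rightarrow> nat"
    where r: "continuous_on UNIV r" "range r = E"
    using closed_Baire_retract[of E] by blast
  have "continuous_on UNIV (c \<circ> r)"
    using r(1) cc by (intro continuous_on_compose) (auto intro: continuous_on_subset)
  moreover have "range (c \<circ> r) = S"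
    unfolding image_comp[symmetric] r(2) by (rule im)
  ultimately show ?thesis
    by (auto simp: analytic_set_def)
qed

subsection \<open>Descriptive complexity of the topology\<close>

lemma fsigma_delta_Collect:
  fixes Q :: "nat \<Rightarrow> nat \<Rightarrow> 'b::topological_space \<Rightarrow> bool"
  assumes "\<And>i k. closed {c. Q i k c}"
  shows "fsigma_delta {c. \<forall>i. \<exists>k. Q i k c}"
proof -
  have "fsigma (\<Union>k. {c. Q i k c})" for i
    using assms by (intro fsigma.intros) auto
  moreover have "{c. \<forall>i. \<exists>k. Q i k c} = (\<Inter>i. \<Union>k. {c. Q i k c})"
    by auto
  ultimately show ?thesis
    unfolding fsigma_delta_def by (intro exI[of _ "\<lambda>i. \<Union>k. {c. Q i k c}"] conjI allI)
qed

lemma closed_coordinate: "closed {c :: 'a \<Rightarrow> 'b::discrete_topology. c x \<in> B}"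
proof -
  have "continuous_on UNIV (\<lambda>c :: 'a \<Rightarrow> 'b. c x)"
    by (rule continuous_on_product_coordinates)
  then have "closed ((\<lambda>c :: 'a \<Rightarrow> 'b. c x) -` B)"
    by (intro closed_vimage) (auto simp: closed_def open_discrete)
  then show ?thesis by (simp add: vimage_def)
qed

text \<open>Over a countable space the quantifiers over \<open>n\<close>, \<open>x\<close> and
  \<open>k\<close> are countable, and for fixed values the condition on the characteristic function
  of \<open>U\<close> is closed, being built from single coordinates. The sets \<open>K n\<close>
  are the whole space in the first countable case and compact in the other.\<close>

lemma fsigma_delta_topologyI:
  fixes K :: "nat \<Rightarrow> 'a::{topological_space,countable} set" and B :: "nat \<Rightarrow> 'a \<Rightarrow> nat \<Rightarrow> 'a set"
  assumes "\<And>U. open U \<longleftrightarrow> (\<forall>n. \<forall>x \<in> K n \<inter> U. \<exists>k. B n x k \<inter> K n \<subseteq> U)"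
  shows "fsigma_delta_topology (euclidean :: 'a topology)"
proof -
  define Q where "Q i k c \<longleftrightarrow> (case prod_decode i of (n, j) \<Rightarrow>
      let x = from_nat j in x \<notin> K n \<or> \<not> c x \<or> (\<forall>y\<in>B n x k \<inter> K n. c y))" for i k :: nat and c
  have "closed {c. Q i k c}" for i k
  proof -
    obtain n j where ij: "prod_decode i = (n, j)" by fastforce
    have "{c. Q i k c} = {c. from_nat j \<notin> K n} \<union> {c. c (from_nat j) \<in> {False}} \<union>
       (\<Inter>y\<in>B n (from_nat j) k \<inter> K n. {c. c y \<in> {True}})"
      by (auto simp: Q_def ij Let_def)
    also have "closed \<dots>"
      by (intro closed_Un closed_INT ballI closed_coordinate) auto
    finally show ?thesis .
  qed
  then have "fsigma_delta {c. \<forall>i. \<exists>k. Q i k c}"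
    by (rule fsigma_delta_Collect)
  also have "{c. \<forall>i. \<exists>k. Q i k c} = {c. openin euclidean {x. c x}}"
  proof (rule Collect_cong)
    fix c :: "'a \<Rightarrow> bool"
    have "(\<forall>i. \<exists>k. Q i k c) \<longleftrightarrow> (\<forall>n. \<forall>x::'a. \<exists>k. Q (prod_encode (n, to_nat x)) k c)"
    proof (intro iffI allI)
      fix i assume a: "\<forall>n. \<forall>x::'a. \<exists>k. Q (prod_encode (n, to_nat x)) k c"
      obtain n j where ij: "prod_decode i = (n, j)" by fastforce
      from a obtain k where "Q (prod_encode (n, to_nat (from_nat j :: 'a))) k c" by blast
      then have "Q i k c" by (simp add: Q_def ij)
      then show "\<exists>k. Q i k c" ..
    qed auto
    also have "\<dots> \<longleftrightarrow> (\<forall>n x. x \<in> K n \<inter> {x. c x} \<longrightarrow> (\<exists>k. B n x k \<inter> K n \<subseteq> {x. c x}))"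
      unfolding Q_def Let_def by (auto simp: subset_eq)
    also have "\<dots> \<longleftrightarrow> openin euclidean {x. c x}"
      using assms[of "{x. c x}"] by auto
    finally show "(\<forall>i. \<exists>k. Q i k c) \<longleftrightarrow> openin euclidean {x. c x}" .
  qed
  finally show ?thesis
    unfolding fsigma_delta_topology_def open_set_indicators_def .
qed

lemma first_countable_imp_fsigma_delta:
  assumes "first_countable (euclidean :: 'a::{topological_space,countable} topology)"
  shows "fsigma_delta_topology (euclidean :: 'a topology)"
proof -
  have "\<exists>B :: nat \<Rightarrow> 'a set. (\<forall>k. open (B k) \<and> x \<in> B k) \<and> (\<forall>U. open U \<and> x \<in> U \<longrightarrow> (\<exists>k. B k \<subseteq> U))" for x
  proof -
    have "\<exists>\<B>. countable \<B> \<and> (\<forall>V\<in>\<B>. open V) \<and>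
        (\<forall>U. open U \<and> x \<in> U \<longrightarrow> (\<exists>V\<in>\<B>. x \<in> V \<and> V \<subseteq> U))"
      using assms by (simp add: first_countable_def)
    then obtain \<B> where BB: "countable \<B> \<and> (\<forall>V\<in>\<B>. open V) \<and>
        (\<forall>U. open U \<and> x \<in> U \<longrightarrow> (\<exists>V\<in>\<B>. x \<in> V \<and> V \<subseteq> U))" ..
    have B: "countable \<B>" "\<And>V. V \<in> \<B> \<Longrightarrow> open V"
        "\<And>U. open U \<Longrightarrow> x \<in> U \<Longrightarrow> \<exists>V\<in>\<B>. x \<in> V \<and> V \<subseteq> U"
      using BB by auto
    let ?C = "{V\<in>\<B>. x \<in> V}"
    have "countable ?C" "?C \<noteq> {}"
      using B(1) B(3)[of UNIV] by auto
    then have r: "range (from_nat_into ?C) = ?C"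
      by (rule range_from_nat_into[rotated])
    show ?thesis
    proof (intro exI[of _ "from_nat_into ?C"] conjI allI impI)
      fix k
      have "from_nat_into ?C k \<in> ?C" using r by blast
      then show "open (from_nat_into ?C k)" "x \<in> from_nat_into ?C k" using B(2) by blast+
    next
      fix U assume "open U \<and> x \<in> U"
      then obtain V where "V \<in> ?C" "V \<subseteq> U" using B(3) by blast
      then show "\<exists>k. from_nat_into ?C k \<subseteq> U" using r by (metis (no_types) imageE)
    qed
  qed
  then obtain B :: "'a \<Rightarrow> nat \<Rightarrow> 'a set"
    where B: "\<And>x k. open (B x k) \<and> x \<in> B x k" "\<And>x U. open U \<Longrightarrow> x \<in> U \<Longrightarrow> \<exists>k. B x k \<subseteq> U"
    by metis
  show ?thesis
  proof (rule fsigma_delta_topologyI[where K = "\<lambda>_. UNIV" and B = "\<lambda>_. B"])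
    fix U :: "'a set"
    show "open U \<longleftrightarrow> (\<forall>n::nat. \<forall>x \<in> UNIV \<inter> U. \<exists>k. B x k \<inter> UNIV \<subseteq> U)"
    proof
      assume "\<forall>n::nat. \<forall>x \<in> UNIV \<inter> U. \<exists>k. B x k \<inter> UNIV \<subseteq> U"
      then show "open U"
        using B(1) by (intro Topological_Spaces.openI) (metis IntI UNIV_I inf_top.right_neutral)
    qed (use B(2) in auto)
  qed
qed

text \<open>Separate \<open>x\<close> from each of the countably many other points by disjoint open
  sets. Finite intersections of the sets around \<open>x\<close> suffice, since finitely many of the
  opposite sets cover the compact set \<open>K - U\<close>.\<close>

lemma countable_compact_first_countable:
  fixes K :: "'a::{t2_space,countable} set"
  assumes "compact K"
  shows "\<exists>B :: nat \<Rightarrow> 'a set. (\<forall>k. open (B k) \<and> x \<in> B k) \<and>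
           (\<forall>U. open U \<and> x \<in> U \<longrightarrow> (\<exists>k. B k \<inter> K \<subseteq> U))"
proof -
  have "\<exists>P. open (fst P) \<and> x \<in> fst P \<and> open (snd P) \<and> fst P \<inter> snd P = {} \<and> (y \<noteq> x \<longrightarrow> y \<in> snd P)" for y
  proof (cases "y = x")
    case True
    then show ?thesis by (intro exI[of _ "(UNIV, {})"]) auto
  next
    case False
    then obtain U V where "open U" "open V" "x \<in> U" "y \<in> V" "U \<inter> V = {}"
      using hausdorff[of x y] by metis
    then show ?thesis by (intro exI[of _ "(U, V)"]) simp
  qed
  then obtain P where P: "\<And>y. open (fst (P y)) \<and> x \<in> fst (P y) \<and> open (snd (P y)) \<and>
      fst (P y) \<inter> snd (P y) = {} \<and> (y \<noteq> x \<longrightarrow> y \<in> snd (P y))"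
    by metis
  define B where "B k = (\<Inter>i\<in>{..k}. fst (P (from_nat i)))" for k :: nat
  have "open (B k) \<and> x \<in> B k" for k
    unfolding B_def using P by (auto intro: open_INT)
  moreover have "\<exists>k. B k \<inter> K \<subseteq> U" if U: "open U" "x \<in> U" for U
  proof -
    have "compact (K - U)"
      using assms U by (simp add: compact_diff)
    moreover have "y \<in> snd (P y)" if "y \<in> K - U" for y
      using P[of y] U that by auto
    then have "K - U \<subseteq> (\<Union>y\<in>K - U. snd (P y))"
      by blast
    moreover have "open (snd (P y))" for y
      using P[of y] by simp
    ultimately obtain Y where Y: "Y \<subseteq> K - U" "finite Y" "K - U \<subseteq> (\<Union>y\<in>Y. snd (P y))"
      by (metis compactE_image)
    define k where "k = Max (to_nat ` Y)"
    have "B k \<inter> K \<subseteq> U"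
    proof (rule ccontr)
      assume "\<not> B k \<inter> K \<subseteq> U"
      then obtain z where z: "z \<in> B k" "z \<in> K - U" by blast
      then obtain y where y: "y \<in> Y" "z \<in> snd (P y)"
        using Y(3) by blast
      have "to_nat y \<le> k"
        unfolding k_def using Y(2) y(1) by simp
      then have "z \<in> fst (P y)"
        using z(1) by (force simp: B_def)
      then show False
        using y(2) P[of y] by blast
    qed
    then show ?thesis ..
  qed
  ultimately show ?thesis by blast
qed

lemma k_omega_imp_fsigma_delta:
  assumes "k_omega_space (euclidean :: 'a::{t2_space,countable} topology)"
  shows "fsigma_delta_topology (euclidean :: 'a topology)"
proof -
  obtain K :: "nat \<Rightarrow> 'a set" where K: "\<And>n. compact (K n)"
     "\<And>U. open U \<longleftrightarrow> (\<forall>n. openin (top_of_set (K n)) (U \<inter> K n))"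
    using assms by (auto simp: k_omega_space_def)
  define R where "R n x B \<longleftrightarrow> (\<forall>k. open (B k) \<and> x \<in> B k) \<and>
      (\<forall>U. open U \<and> x \<in> U \<longrightarrow> (\<exists>k. B k \<inter> K n \<subseteq> U))" for n x and B :: "nat \<Rightarrow> 'a set"
  have "\<exists>B. R n x B" for n x
    unfolding R_def by (rule countable_compact_first_countable[OF K(1)])
  then obtain B where "\<And>n x. R n x (B n x)"
    by metis
  then have B: "\<And>n x k. open (B n x k) \<and> x \<in> B n x k"
      "\<And>n x U. open U \<Longrightarrow> x \<in> U \<Longrightarrow> \<exists>k. B n x k \<inter> K n \<subseteq> U"
    unfolding R_def by blast+
  show ?thesis
  proof (rule fsigma_delta_topologyI[where K = K and B = B])
    fix U :: "'a set"
    show "open U \<longleftrightarrow> (\<forall>n. \<forall>x \<in> K n \<inter> U. \<exists>k. B n x k \<inter> K n \<subseteq> U)"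
    proof
      assume *: "\<forall>n. \<forall>x \<in> K n \<inter> U. \<exists>k. B n x k \<inter> K n \<subseteq> U"
      have "openin (top_of_set (K n)) (U \<inter> K n)" for n
      proof (subst openin_subopen, safe)
        fix x assume x: "x \<in> U" "x \<in> K n"
        then obtain k where "B n x k \<inter> K n \<subseteq> U"
          using * by blast
        then show "\<exists>T. openin (top_of_set (K n)) T \<and> x \<in> T \<and> T \<subseteq> U \<inter> K n"
          using B(1)[of n x k] x by (intro exI[of _ "K n \<inter> B n x k"]) auto
      qed
      then show "open U" using K(2) by blast
    qed (use B(2) in auto)
  qed
qed

subsection \<open>Kernels of parametrised neighbourhood bases\<close>

lemma closed_cylD:
  assumes "closed K" "\<And>n. K \<inter> cyl \<alpha> n \<noteq> {}"
  shows "\<alpha> \<in> K"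
proof (rule ccontr)
  assume "\<alpha> \<notin> K"
  then obtain n where "cyl \<alpha> n \<subseteq> - K"
    using open_contains_cyl[of "- K" \<alpha>] assms(1) by auto
  then show False
    using assms(2)[of n] by blast
qed

text \<open>For fixed \<open>g\<close> and \<open>K\<close> there are only countably many such sets,
  at most one for each cylinder.\<close>

definition core :: "((nat \<Rightarrow> nat) \<Rightarrow> 'a set) \<Rightarrow> (nat \<Rightarrow> nat) set \<Rightarrow> (nat \<Rightarrow> nat) \<Rightarrow> nat \<Rightarrow> 'a set" where
  "core g K \<alpha> n = \<Inter>(g ` (K \<inter> cyl \<alpha> n))"

text \<open>\<open>K\<close> is what remains of the Baire space after removing every cylinder on which
  countably many sets satisfying \<open>P\<close> suffice.\<close>

lemma kernel_dichotomy:
  fixes g :: "(nat \<Rightarrow> nat) \<Rightarrow> 'a set"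
  obtains (network) \<N> where "countable \<N>" "\<And>N. N \<in> \<N> \<Longrightarrow> P N" "\<And>\<alpha>. \<exists>N\<in>\<N>. N \<subseteq> g \<alpha>"
  | (kernel) K where "closed K" "K \<noteq> {}" "\<And>\<alpha> n. \<alpha> \<in> K \<Longrightarrow> \<not> P (core g K \<alpha> n)"
proof -
  define cov where "cov \<N> S \<longleftrightarrow> countable \<N> \<and> (\<forall>N\<in>\<N>. P N) \<and> (\<forall>\<beta>\<in>S. \<exists>N\<in>\<N>. N \<subseteq> g \<beta>)" for \<N> S
  define \<C> where "\<C> = {S \<in> range (\<lambda>(\<alpha>, n). cyl \<alpha> n). \<exists>\<N>. cov \<N> S}"
  have "\<forall>S\<in>\<C>. \<exists>\<N>. cov \<N> S"
    by (simp add: \<C>_def)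
  then obtain nn where nn: "\<And>S. S \<in> \<C> \<Longrightarrow> cov (nn S) S"
    by metis
  define \<U> where "\<U> = \<Union>(nn ` \<C>)"
  have "countable \<C>"
    unfolding \<C>_def by (rule countable_subset[OF _ countable_cylinders]) blast
  then have U: "cov \<U> (\<Union>\<C>)"
    unfolding cov_def
  proof (intro conjI ballI)
    show "countable \<U>"
      unfolding \<U>_def using \<open>countable \<C>\<close> nn by (intro countable_UN) (auto simp: cov_def)
  next
    fix N assume "N \<in> \<U>"
    then show "P N" using nn by (auto simp: \<U>_def cov_def)
  next
    fix \<beta> assume "\<beta> \<in> \<Union>\<C>"
    then obtain S where S: "S \<in> \<C>" "\<beta> \<in> S" by blast
    then obtain N where "N \<in> nn S" "N \<subseteq> g \<beta>"
      using nn[OF S(1)] unfolding cov_def by blast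
    then show "\<exists>N\<in>\<U>. N \<subseteq> g \<beta>"
      using S(1) by (auto simp: \<U>_def)
  qed
  define K where "K = - \<Union>\<C>"
  have clK: "closed K"
    unfolding K_def closed_def by (auto simp: \<C>_def intro!: open_Union open_cyl)
  show thesis
  proof (cases "K = {}")
    case True
    then have "\<Union>\<C> = UNIV"
      unfolding K_def by blast
    with U have "countable \<U>" "\<And>N. N \<in> \<U> \<Longrightarrow> P N" "\<And>\<alpha>. \<exists>N\<in>\<U>. N \<subseteq> g \<alpha>"
      unfolding cov_def by auto
    then show thesis by (rule network)
  next
    case False
    have "\<not> P (core g K \<alpha> n)" if "\<alpha> \<in> K" for \<alpha> n
    proof
      assume P: "P (core g K \<alpha> n)"
      \<comment> \<open>Parameters outside \<open>K\<close> are already served by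
        \<open>\<U>\<close> and those in \<open>K\<close> by the core; so a core with
        \<open>P\<close> would put this cylinder into \<open>\<C>\<close>, although it contains
        \<open>\<alpha> \<in> K\<close>.\<close>
      have "cov (insert (core g K \<alpha> n) \<U>) (cyl \<alpha> n)"
        unfolding cov_def
      proof (intro conjI ballI)
        fix \<beta> assume b: "\<beta> \<in> cyl \<alpha> n"
        show "\<exists>N\<in>insert (core g K \<alpha> n) \<U>. N \<subseteq> g \<beta>"
        proof (cases "\<beta> \<in> K")
          case True
          with b have "core g K \<alpha> n \<subseteq> g \<beta>" by (auto simp: core_def)
          then show ?thesis by blast
        next
          case False
          then have "\<beta> \<in> \<Union>\<C>" by (simp add: K_def)
          then show ?thesis using U unfolding cov_def by blast
        qed
      qed (use U P in \<open>auto simp: cov_def\<close>)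
      then have "cyl \<alpha> n \<in> \<C>"
        unfolding \<C>_def by blast
      then show False
        using that cyl_self[of \<alpha> n] unfolding K_def by blast
    qed
    with clK False show thesis
      by (rule kernel)
  qed
qed

text \<open>Otherwise every relative cylinder of \<open>K\<close> contains, for arbitrarily large
  \<open>i\<close>, some \<open>\<beta>\<close> with \<open>s i\<close> outside
  \<open>g \<beta>\<close>, and by \<open>cont\<close> this persists on a smaller cylinder.
  Iterating gives nested cylinders whose common point \<open>\<alpha>\<close> lies in
  \<open>K\<close> but has infinitely many terms outside \<open>g \<alpha>\<close>.\<close>

lemma sequence_in_core:
  fixes g :: "(nat \<Rightarrow> nat) \<Rightarrow> 'a set" and s :: "nat \<Rightarrow> 'a"
  assumes "closed K" "K \<noteq> {}"
    and cont: "\<And>\<alpha> x. \<exists>n. \<forall>\<beta>\<in>cyl \<alpha> n. x \<in> g \<beta> \<longleftrightarrow> x \<in> g \<alpha>"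
    and ev: "\<And>\<alpha>. \<alpha> \<in> K \<Longrightarrow> \<forall>\<^sub>F i in sequentially. s i \<in> g \<alpha>"
  shows "\<exists>\<alpha>\<in>K. \<exists>n. \<forall>\<^sub>F i in sequentially. s i \<in> core g K \<alpha> n"
proof (rule ccontr)
  assume neg: "\<not> ?thesis"
  \<comment> \<open>A state is a point of \<open>K\<close>, a cylinder length and the index of a
    term missed on the entire cylinder. At stage \<open>k\<close>, \<open>k \<le> i\<close> makes
    the missed terms late and \<open>k \<le> n\<close> makes the cylinders shrink to a
    point.\<close>
  define P where "P k st \<longleftrightarrow> (case st of (\<beta>, n, i) \<Rightarrow>
     \<beta> \<in> K \<and> (\<forall>\<gamma>\<in>cyl \<beta> n. s i \<notin> g \<gamma>) \<and> k \<le> i \<and> k \<le> n)"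
    for k :: nat and st :: "(nat \<Rightarrow> nat) \<times> nat \<times> nat"
  define Q where "Q st st' \<longleftrightarrow> fst st' \<in> cyl (fst st) (fst (snd st)) \<and> fst (snd st) \<le> fst (snd st')"
    for st st' :: "(nat \<Rightarrow> nat) \<times> nat \<times> nat"
  have step: "\<exists>st. P k st \<and> fst st \<in> cyl \<alpha> n \<and> n \<le> fst (snd st)" if a: "\<alpha> \<in> K" for \<alpha> n k
  proof -
    have "\<not> (\<forall>\<^sub>F i in sequentially. s i \<in> core g K \<alpha> n)"
      using neg a by blast
    then obtain i where i: "k \<le> i" "s i \<notin> core g K \<alpha> n"
      unfolding eventually_sequentially by blast
    then obtain \<beta> where b: "\<beta> \<in> K" "\<beta> \<in> cyl \<alpha> n" "s i \<notin> g \<beta>"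
      by (auto simp: core_def)
    obtain m where m: "\<forall>\<gamma>\<in>cyl \<beta> m. s i \<in> g \<gamma> \<longleftrightarrow> s i \<in> g \<beta>"
      using cont by blast
    have "s i \<notin> g \<gamma>" if "\<gamma> \<in> cyl \<beta> (max m (max n k))" for \<gamma>
      using that m b(3) cyl_mono[of m "max m (max n k)" \<beta>] by auto
    then show ?thesis
      using b i(1) by (intro exI[of _ "(\<beta>, max m (max n k), i)"]) (auto simp: P_def)
  qed
  obtain \<alpha>0 where "\<alpha>0 \<in> K" using assms(2) by blast
  then have "\<exists>st. P 0 st"
    using step[of \<alpha>0 0 0] by blast
  moreover have "\<exists>st'. P (Suc k) st' \<and> Q st st'" if "P k st" for st k
  proof -
    have "fst st \<in> K" using that by (auto simp: P_def)
    from step[OF this, of "Suc k" "fst (snd st)"] show ?thesis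
      by (simp add: Q_def)
  qed
  ultimately obtain st where st: "\<And>k. P k (st k)" "\<And>k. Q (st k) (st (Suc k))"
    using dependent_nat_choice[of P "\<lambda>_. Q"] by metis
  define \<beta> n i where "\<beta> k = fst (st k)" and "n k = fst (snd (st k))" and "i k = snd (snd (st k))" for k
  have b: "\<beta> k \<in> K" "\<And>\<gamma>. \<gamma> \<in> cyl (\<beta> k) (n k) \<Longrightarrow> s (i k) \<notin> g \<gamma>" "k \<le> i k" "k \<le> n k" for k
    using st(1)[of k] by (auto simp: P_def \<beta>_def n_def i_def split: prod.splits)
  have q: "\<beta> (Suc k) \<in> cyl (\<beta> k) (n k)" "n k \<le> n (Suc k)" for k
    using st(2)[of k] by (auto simp: Q_def \<beta>_def n_def)
  have nested: "cyl (\<beta> l) (n l) \<subseteq> cyl (\<beta> k) (n k)" if "k \<le> l" for k l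
    using that
  proof (induction rule: dec_induct)
    case (step l)
    then show ?case
      using cyl_trans[OF q(1)[of l] q(2)[of l]] by blast
  qed simp
  have agree: "\<beta> l j = \<beta> k j" if "k \<le> l" "j < n k" for k l j
    using nested[OF that(1)] cyl_self[of "\<beta> l" "n l"] that(2) by (auto simp: cyl_def)
  \<comment> \<open>Coordinate \<open>j\<close> is read at stage \<open>Suc j\<close>, where the
    length exceeds \<open>j\<close>, so that later stages no longer change it.\<close>
  define \<alpha> where "\<alpha> j = \<beta> (Suc j) j" for j
  have a: "\<alpha> \<in> cyl (\<beta> k) (n k)" for k
  proof -
    have "\<beta> (Suc j) j = \<beta> k j" if "j < n k" for j
    proof (cases "k \<le> Suc j")
      case True
      then show ?thesis using agree that by blast
    next
      case False
      then show ?thesis using agree[of "Suc j" k j] b(4)[of "Suc j"] by simp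
    qed
    then show ?thesis by (simp add: cyl_def \<alpha>_def)
  qed
  have "K \<inter> cyl \<alpha> k \<noteq> {}" for k
  proof -
    have "\<beta> k \<in> cyl \<alpha> k"
      using a[of k] b(4)[of k] by (auto simp: cyl_def)
    then show ?thesis using b(1) by blast
  qed
  then have "\<alpha> \<in> K"
    by (rule closed_cylD[OF assms(1)])
  from ev[OF this] obtain k where "\<And>i. i \<ge> k \<Longrightarrow> s i \<in> g \<alpha>"
    unfolding eventually_sequentially by blast
  then show False
    using b(2)[OF a[of k]] b(3)[of k] by blast
qed

subsection \<open>Sequential groups\<close>

lemma sequentially_closed_imp_closed:
  assumes "sequential_space (euclidean :: 'a::topological_space topology)"
    and "\<And>s x. (\<And>n. s n \<in> A) \<Longrightarrow> s \<longlonglongrightarrow> x \<Longrightarrow> x \<in> A"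
  shows "closed (A :: 'a set)"
proof (rule ccontr)
  assume "\<not> closed A"
  then have "euclidean closure_of A - A \<noteq> {}"
    using closure_subset[of A] closed_closure[of A] by (metis Diff_eq_empty_iff euclidean_closure_of subset_antisym)
  then obtain s :: "nat \<Rightarrow> 'a" and x where s: "range s \<subseteq> A" "x \<in> closure A - A" "s \<longlonglongrightarrow> x"
    using assms(1) unfolding sequential_space_def by (metis euclidean_closure_of limitin_canonical_iff subset_UNIV topspace_euclidean)
  then show False
    using assms(2)[of s x] by blast
qed

lemma sequentially_open_imp_open:
  assumes "sequential_space (euclidean :: 'a::topological_space topology)"
    and "\<And>s x. x \<in> U \<Longrightarrow> s \<longlonglongrightarrow> x \<Longrightarrow> \<forall>\<^sub>F n in sequentially. s n \<in> U"
  shows "open (U :: 'a set)"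
proof -
  have "closed (- U)"
  proof (rule sequentially_closed_imp_closed[OF assms(1)])
    fix s x assume s: "\<And>n. s n \<in> - U" "s \<longlonglongrightarrow> x"
    show "x \<in> - U"
    proof
      assume "x \<in> U"
      from assms(2)[OF this s(2)] show False
        using s(1) by simp
    qed
  qed
  then show ?thesis by (simp add: open_closed)
qed

section \<open>Regularity and continuity of the group operations\<close>

lemma regular_neighbourhood:
  fixes x :: "'a::t3_space"
  assumes "open U" "x \<in> U"
  obtains V where "open V" "x \<in> V" "closure V \<subseteq> U"
proof -
  obtain V W where VW: "open V" "open W" "x \<in> V" "- U \<subseteq> W" "V \<inter> W = {}"
    using t3_space[of "- U" x] assms by (auto simp: closed_def)
  then have "V \<subseteq> - W" by blast
  then have "closure V \<subseteq> - W"
    using VW(2) by (intro closure_minimal) auto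
  then show thesis
    using that VW by blast
qed

lemma open_add_split:
  fixes a b :: "'a::topological_monoid_add"
  assumes "open U" "a + b \<in> U"
  obtains V W where "open V" "a \<in> V" "open W" "b \<in> W" "\<And>v w. v \<in> V \<Longrightarrow> w \<in> W \<Longrightarrow> v + w \<in> U"
proof -
  have "\<forall>\<^sub>F p in nhds a \<times>\<^sub>F nhds b. fst p + snd p \<in> U"
    using topological_tendstoD[OF tendsto_add_Pair assms] .
  then obtain P Q where PQ: "eventually P (nhds a)" "eventually Q (nhds b)"
      "\<And>x y. P x \<Longrightarrow> Q y \<Longrightarrow> x + y \<in> U"
    unfolding eventually_prod_filter by auto
  obtain V where V: "open V" "a \<in> V" "\<And>x. x \<in> V \<Longrightarrow> P x"
    using PQ(1) unfolding eventually_nhds by blast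
  obtain W where W: "open W" "b \<in> W" "\<And>x. x \<in> W \<Longrightarrow> Q x"
    using PQ(2) unfolding eventually_nhds by blast
  show thesis
    using that[OF V(1,2) W(1,2)] PQ(3) V(3) W(3) by blast
qed

lemma open_left_translation:
  fixes a :: "'a::topological_group_add"
  assumes "open U"
  shows "open {y. a + y \<in> U}"
proof -
  have "open ((\<lambda>y. a + y) -` U)"
    using assms by (intro open_vimage continuous_intros)
  then show ?thesis by (simp add: vimage_def)
qed

lemma tendsto_zero_left_translation:
  fixes x :: "'a::topological_group_add"
  assumes "s \<longlonglongrightarrow> x"
  shows "(\<lambda>i. - x + s i) \<longlonglongrightarrow> 0"
  using tendsto_add[OF tendsto_const[of "- x"] assms] by simp

text \<open>Two sequences picked from the decreasing sequential neighbourhoods \<open>G m\<close> converge to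
  \<open>0\<close>, hence so does their sum; therefore \<open>G m + G m \<subseteq> G n\<close> for some \<open>m\<close>, and this makes
  the subset \<open>V n\<close> of \<open>G n\<close> sequentially open.\<close>

lemma sequential_neighbourhoods_imp_first_countable:
  fixes \<C> :: "'a::topological_group_add set set"
  assumes seq: "sequential_space (euclidean :: 'a topology)"
    and "countable \<C>"
    and nbhd: "\<And>C s. C \<in> \<C> \<Longrightarrow> s \<longlonglongrightarrow> 0 \<Longrightarrow> \<forall>\<^sub>F i in sequentially. s i \<in> C"
    and net: "\<And>U. open U \<Longrightarrow> 0 \<in> U \<Longrightarrow> \<exists>C\<in>\<C>. C \<subseteq> U"
  shows "first_countable (euclidean :: 'a topology)"
proof -
  have ne: "\<C> \<noteq> {}"
    using net[of UNIV] by auto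
  define C where "C = from_nat_into \<C>"
  have C: "range C = \<C>"
    unfolding C_def by (rule range_from_nat_into[OF ne assms(2)])
  define G where "G n = (\<Inter>i\<le>n. C i)" for n
  have G_nbhd: "\<forall>\<^sub>F i in sequentially. s i \<in> G n" if s: "s \<longlonglongrightarrow> 0" for s n
  proof -
    have "\<forall>\<^sub>F i in sequentially. \<forall>j\<in>{..n}. s i \<in> C j"
      using nbhd[OF _ s] C by (intro eventually_ball_finite) auto
    then show ?thesis by (simp add: G_def)
  qed
  have G0: "0 \<in> G n" for n
    using G_nbhd[OF tendsto_const[of 0]] by simp
  have G_mono: "G m \<subseteq> C n" if "n \<le> m" for m n
    using that by (auto simp: G_def)
  have G_net: "\<exists>n. G n \<subseteq> U" if "open U" "0 \<in> U" for U
    using net[OF that] C G_mono[OF order.refl] by (metis imageE subset_trans)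
  have G_tendsto: "x \<longlonglongrightarrow> 0" if x: "\<And>m. x m \<in> G m" for x
  proof (rule topological_tendstoI)
    fix U :: "'a set" assume "open U" "0 \<in> U"
    then obtain n where "C n \<subseteq> U"
      using net C by blast
    then have "x m \<in> U" if "n \<le> m" for m
      using x[of m] G_mono[OF that] by blast
    then show "\<forall>\<^sub>F m in sequentially. x m \<in> U"
      by (rule eventually_sequentiallyI)
  qed
  have double: "\<exists>m. \<forall>x\<in>G m. \<forall>y\<in>G m. x + y \<in> G n" for n
  proof (rule ccontr)
    assume "\<not> ?thesis"
    then obtain x y where xy: "\<And>m. x m \<in> G m" "\<And>m. y m \<in> G m" "\<And>m. x m + y m \<notin> G n"
      by metis
    have "(\<lambda>m. x m + y m) \<longlonglongrightarrow> 0"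
      using tendsto_add[OF G_tendsto[OF xy(1)] G_tendsto[OF xy(2)]] by simp
    from G_nbhd[OF this, of n] show False
      using xy(3) by simp
  qed
  define V where "V n = {y. \<exists>m. \<forall>z\<in>G m. y + z \<in> G n}" for n
  have V_open: "open (V n)" for n
  proof (rule sequentially_open_imp_open[OF seq])
    fix s x assume "x \<in> V n" "s \<longlonglongrightarrow> x"
    then obtain m where m: "\<And>z. z \<in> G m \<Longrightarrow> x + z \<in> G n"
      by (auto simp: V_def)
    obtain k where k: "\<And>y z. y \<in> G k \<Longrightarrow> z \<in> G k \<Longrightarrow> y + z \<in> G m"
      using double by blast
    have "\<forall>\<^sub>F i in sequentially. - x + s i \<in> G k"
      using tendsto_zero_left_translation[OF \<open>s \<longlonglongrightarrow> x\<close>] by (rule G_nbhd)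
    then show "\<forall>\<^sub>F i in sequentially. s i \<in> V n"
    proof (rule eventually_mono)
      fix i assume i: "- x + s i \<in> G k"
      have "s i + z \<in> G n" if "z \<in> G k" for z
        using m[OF k[OF i that]] by (simp add: add.assoc[symmetric])
      then show "s i \<in> V n" by (auto simp: V_def)
    qed
  qed
  have V0: "0 \<in> V n" for n
    by (auto simp: V_def intro: exI[of _ n])
  have VG: "V n \<subseteq> G n" for n
    using G0 by (force simp: V_def)
  show ?thesis
    unfolding first_countable_def
  proof
    fix x :: 'a
    let ?B = "range (\<lambda>n. {y. - x + y \<in> V n})"
    have "\<exists>W\<in>?B. x \<in> W \<and> W \<subseteq> U" if U: "open U" "x \<in> U" for U
    proof -
      obtain n where n: "G n \<subseteq> {y. x + y \<in> U}"
        using G_net[OF open_left_translation[OF U(1), of x]] U(2) by auto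
      have "{y. - x + y \<in> V n} \<subseteq> U"
      proof
        fix y assume "y \<in> {y. - x + y \<in> V n}"
        then have "x + (- x + y) \<in> U" using VG n by blast
        then show "y \<in> U" by (simp add: add.assoc[symmetric])
      qed
      then show ?thesis using V0 by auto
    qed
    moreover have "\<forall>W\<in>?B. open W"
      using open_left_translation[OF V_open] by blast
    ultimately show "\<exists>\<B>. countable \<B> \<and> (\<forall>V\<in>\<B>. openin euclidean V) \<and>
       (\<forall>U. openin euclidean U \<and> x \<in> U \<longrightarrow> (\<exists>V\<in>\<B>. x \<in> V \<and> V \<subseteq> U))"
      by (intro exI[of _ ?B]) simp
  qed
qed

section \<open>Thick sets and perturbations avoiding thin ones\<close>

text \<open>The group need not be commutative. With this order a common left translation of
  \<open>a\<close> and \<open>b\<close> cancels in \<open>- a + b\<close>.\<close>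

definition diffs :: "'a::group_add set \<Rightarrow> 'a set" where
  "diffs N = {- a + b | a b. a \<in> N \<and> b \<in> N}"

text \<open>The closure lets a failure of thickness exclude limits: a point outside it is no limit
  of elements of \<open>diffs N\<close>.\<close>

definition thick :: "'a::topological_group_add set \<Rightarrow> bool" where
  "thick N \<longleftrightarrow> (\<forall>s. s \<longlonglongrightarrow> 0 \<longrightarrow> (\<forall>\<^sub>F i in sequentially. s i \<in> closure (diffs N)))"

text \<open>The closures of the sets \<open>diffs N\<close> are countably many sequential
  neighbourhoods of \<open>0\<close>. By regularity and continuity of \<open>- a + b\<close> at
  \<open>0\<close>, a small enough \<open>N\<close> has this closure inside a given
  neighbourhood.\<close>

lemma thick_network_imp_first_countable:
  fixes \<N> :: "'a::{topological_group_add, t3_space} set set"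
  assumes seq: "sequential_space (euclidean :: 'a topology)"
    and "countable \<N>" "\<And>N. N \<in> \<N> \<Longrightarrow> thick N"
    and net: "\<And>U. open U \<Longrightarrow> 0 \<in> U \<Longrightarrow> \<exists>N\<in>\<N>. N \<subseteq> U"
  shows "first_countable (euclidean :: 'a topology)"
proof (rule sequential_neighbourhoods_imp_first_countable[OF seq])
  show "countable ((\<lambda>N. closure (diffs N)) ` \<N>)"
    using assms(2) by simp
  fix U :: "'a set" assume "open U" "0 \<in> U"
  then obtain U' where U': "open U'" "0 \<in> U'" "closure U' \<subseteq> U"
    by (rule regular_neighbourhood)
  then obtain V W where VW: "open V" "0 \<in> V" "open W" "0 \<in> W" "\<And>v w. v \<in> V \<Longrightarrow> w \<in> W \<Longrightarrow> v + w \<in> U'"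
    using open_add_split[of U' 0 0] by auto
  have "open (W \<inter> uminus -` V)"
    using VW(1,3) by (intro open_Int open_vimage continuous_intros)
  then obtain N where N: "N \<in> \<N>" "N \<subseteq> W \<inter> uminus -` V"
    using net[of "W \<inter> uminus -` V"] VW(2,4) by auto
  then have "diffs N \<subseteq> U'"
    using VW(5) by (auto simp: diffs_def)
  then have "closure (diffs N) \<subseteq> U"
    using U'(3) closure_mono by blast
  then show "\<exists>C\<in>(\<lambda>N. closure (diffs N)) ` \<N>. C \<subseteq> U"
    using N(1) by blast
qed (use assms(3) in \<open>auto simp: thick_def\<close>)

text \<open>Suppose every \<open>y \<in> Y' k\<close> fails for \<open>insert A \<A>\<close>. Since some \<open>x + s a + w\<close> avoids \<open>\<A>\<close>,
  it lies in \<open>A\<close>; differences of two such points of \<open>A\<close> tend to \<open>s a\<close>, which is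
  not in the closure of \<open>- A + A\<close>.\<close>

lemma thin_family_perturbation:
  fixes \<A> :: "'a::topological_group_add set set"
  assumes "finite \<A>" "\<And>A. A \<in> \<A> \<Longrightarrow> \<not> thick A"
  shows "\<exists>Y :: nat \<Rightarrow> 'a set. (\<forall>U. open U \<and> 0 \<in> U \<longrightarrow> (\<forall>\<^sub>F k in sequentially. Y k \<subseteq> U)) \<and>
           (\<forall>x k. \<exists>y\<in>Y k. x + y \<notin> \<Union>\<A>)"
  using assms
proof (induction \<A> rule: finite_induct)
  case empty
  show ?case by (intro exI[of _ "\<lambda>_. {0}"]) auto
next
  case (insert A \<A>)
  then obtain Y :: "nat \<Rightarrow> 'a set"
    where Y: "\<And>U. open U \<Longrightarrow> 0 \<in> U \<Longrightarrow> \<forall>\<^sub>F k in sequentially. Y k \<subseteq> U"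
      "\<And>x k. \<exists>y\<in>Y k. x + y \<notin> \<Union>\<A>"
    by auto
  have "\<not> thick A" using insert by blast
  then obtain s where s: "s \<longlonglongrightarrow> 0" "\<not> (\<forall>\<^sub>F i in sequentially. s i \<in> closure (diffs A))"
    by (auto simp: thick_def)
  have bad: "\<exists>a\<ge>k. s a \<notin> closure (diffs A)" for k
    using s(2) unfolding eventually_sequentially by blast
  \<comment> \<open>Both summands come from tails, so these sets shrink to \<open>0\<close>. The
    index \<open>l\<close> is independent of \<open>a\<close>, so that \<open>s a\<close> can stay
    fixed while \<open>w\<close> tends to \<open>0\<close>.\<close>
  define Y' where "Y' k = {s a + w | a w. k \<le> a \<and> (\<exists>l\<ge>k. w \<in> Y l)}" for k
  have tails: "w \<longlonglongrightarrow> 0" if w: "\<And>n. w n \<in> Y (h n)" "\<And>n. n \<le> h n" for w and h :: "nat \<Rightarrow> nat"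
  proof (rule topological_tendstoI)
    fix U :: "'a set" assume "open U" "0 \<in> U"
    from Y(1)[OF this] obtain k where k: "\<And>l. k \<le> l \<Longrightarrow> Y l \<subseteq> U"
      unfolding eventually_sequentially by blast
    have "w n \<in> U" if "k \<le> n" for n
      using k[OF order.trans[OF that w(2)]] w(1)[of n] by blast
    then show "\<forall>\<^sub>F n in sequentially. w n \<in> U"
      by (rule eventually_sequentiallyI)
  qed
  have "\<forall>\<^sub>F k in sequentially. Y' k \<subseteq> U" if U: "open U" "0 \<in> U" for U
  proof -
    obtain V W where VW: "open V" "0 \<in> V" "open W" "0 \<in> W" "\<And>v w. v \<in> V \<Longrightarrow> w \<in> W \<Longrightarrow> v + w \<in> U"
      using open_add_split[of U 0 0] U by auto
    obtain k1 where k1: "\<And>a. k1 \<le> a \<Longrightarrow> s a \<in> V"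
      using topological_tendstoD[OF s(1) VW(1,2)] unfolding eventually_sequentially by blast
    obtain k2 where k2: "\<And>l. k2 \<le> l \<Longrightarrow> Y l \<subseteq> W"
      using Y(1)[OF VW(3,4)] unfolding eventually_sequentially by blast
    have "Y' k \<subseteq> U" if k: "max k1 k2 \<le> k" for k
    proof
      fix y assume "y \<in> Y' k"
      then obtain a w l where "y = s a + w" "k \<le> a" "k \<le> l" "w \<in> Y l"
        by (auto simp: Y'_def)
      then show "y \<in> U"
        using VW(5)[OF k1[of a], of w] k2[of l] k by auto
    qed
    then show ?thesis by (rule eventually_sequentiallyI)
  qed
  moreover have "\<exists>y\<in>Y' k. x + y \<notin> \<Union>(insert A \<A>)" for x k
  proof (rule ccontr)
    assume neg: "\<not> ?thesis"
    have inA: "\<exists>w\<in>Y l. x + (s a + w) \<in> A" if "k \<le> a" "k \<le> l" for a l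
    proof -
      obtain w where w: "w \<in> Y l" "(x + s a) + w \<notin> \<Union>\<A>"
        using Y(2)[where x = "x + s a" and k = l] by auto
      have "s a + w \<in> Y' k"
        using that w(1) by (auto simp: Y'_def)
      then have "x + (s a + w) \<in> \<Union>(insert A \<A>)"
        using neg by blast
      then show ?thesis
        using w by (auto simp: add.assoc)
    qed
    obtain a where a: "k \<le> a" "s a \<notin> closure (diffs A)"
      using bad by blast
    \<comment> \<open>The maximum with \<open>k\<close> keeps the sums in \<open>Y' k\<close>, while
      \<open>h\<close> still tends to infinity.\<close>
    define h where "h n = max k n" for n
    have h: "k \<le> h n" "n \<le> h n" for n
      by (auto simp: h_def)
    obtain w where w: "\<And>n. w n \<in> Y (h n)" "\<And>n. x + (s a + w n) \<in> A"
      using inA[OF a(1) h(1)] by metis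
    have "\<exists>v\<in>Y (h n). x + (s (h n) + v) \<in> A" for n
      by (rule inA[OF h(1) h(1)])
    then obtain v where v: "\<And>n. v n \<in> Y (h n)" "\<And>n. x + (s (h n) + v n) \<in> A"
      by metis
    have "filterlim h at_top sequentially"
      using h(2) by (intro filterlim_at_top_mono[OF filterlim_ident]) auto
    then have "(\<lambda>n. s (h n)) \<longlonglongrightarrow> 0"
      using s(1) by (rule filterlim_compose[rotated])
    then have "(\<lambda>n. - (s (h n) + v n) + (s a + w n)) \<longlonglongrightarrow> - (0 + 0) + (s a + 0)"
      by (intro tendsto_intros tails[OF v(1) h(2)] tails[OF w(1) h(2)])
    moreover have "- (s (h n) + v n) + (s a + w n) \<in> diffs A" for n
    proof -
      have "- (s (h n) + v n) + (s a + w n) = - (x + (s (h n) + v n)) + (x + (s a + w n))"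
        by (simp only: minus_add add.assoc minus_add_cancel)
      then show ?thesis
        using v(2)[of n] w(2)[of n] unfolding diffs_def by blast
    qed
    then have "\<forall>\<^sub>F n in sequentially. - (s (h n) + v n) + (s a + w n) \<in> closure (diffs A)"
      using closure_subset by (intro always_eventually allI) blast
    ultimately have "- (0 + 0) + (s a + 0) \<in> closure (diffs A)"
      by (intro Lim_in_closed_set[OF closed_closure]) auto
    then show False
      using a(2) by simp
  qed
  ultimately show ?case
    by (intro exI[of _ Y'] conjI allI impI) simp_all
qed

section \<open>Locally finite sequences and their perturbations\<close>

text \<open>Indices are counted, not values, so no value recurs infinitely often.\<close>

definition locally_finite_seq :: "(nat \<Rightarrow> 'a::topological_space) \<Rightarrow> bool" where
  "locally_finite_seq x \<longleftrightarrow> (\<forall>p. \<exists>W. open W \<and> p \<in> W \<and> finite {m. x m \<in> W})"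

text \<open>Take an open cover without finite subcover and choose a member \<open>W c\<close> around
  each \<open>c \<in> C\<close>. If \<open>x m\<close> avoids \<open>W c\<close> for the finitely
  many \<open>c\<close> numbered up to \<open>m\<close>, then \<open>W p\<close> contains
  \<open>x m\<close> only for \<open>m < to_nat p\<close>.\<close>

lemma noncompact_locally_finite_seq:
  fixes C :: "'a::{topological_space,countable} set"
  assumes "closed C" "\<not> compact C"
  obtains x where "\<And>m. x m \<in> C" "locally_finite_seq x"
proof -
  obtain \<U> where \<U>: "(\<forall>U\<in>\<U>. open U) \<and> C \<subseteq> \<Union>\<U> \<and>
      \<not> (\<exists>\<D>\<subseteq>\<U>. finite \<D> \<and> C \<subseteq> \<Union>\<D>)"
    using assms(2) unfolding compact_eq_Heine_Borel by (simp only: not_all not_imp conj_assoc) blast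
  then have U: "\<And>U. U \<in> \<U> \<Longrightarrow> open U" "C \<subseteq> \<Union>\<U>"
      "\<And>\<D>. \<D> \<subseteq> \<U> \<Longrightarrow> finite \<D> \<Longrightarrow> \<not> C \<subseteq> \<Union>\<D>"
    by simp_all
  have "\<exists>U\<in>\<U>. c \<in> U" if "c \<in> C" for c
    using U(2) that by blast
  then obtain W where W: "\<And>c. c \<in> C \<Longrightarrow> W c \<in> \<U> \<and> c \<in> W c"
    by metis
  have "\<exists>y. y \<in> C \<and> (\<forall>c\<in>C. to_nat c \<le> m \<longrightarrow> y \<notin> W c)" for m
  proof -
    have "c \<in> from_nat ` {..m}" if "to_nat c \<le> m" for c :: 'a
      using that imageI[of "to_nat c" "{..m}" "from_nat :: nat \<Rightarrow> 'a"] by simp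
    then have "{c \<in> C. to_nat c \<le> m} \<subseteq> from_nat ` {..m}"
      by blast
    then have "finite {c \<in> C. to_nat c \<le> m}"
      by (rule finite_subset) simp
    then have "\<not> C \<subseteq> \<Union>(W ` {c \<in> C. to_nat c \<le> m})"
      using W by (intro U(3)) auto
    then show ?thesis by blast
  qed
  then obtain x where x: "\<And>m. x m \<in> C" "\<And>m c. c \<in> C \<Longrightarrow> to_nat c \<le> m \<Longrightarrow> x m \<notin> W c"
    by metis
  have "locally_finite_seq x"
    unfolding locally_finite_seq_def
  proof
    fix p
    show "\<exists>W. open W \<and> p \<in> W \<and> finite {m. x m \<in> W}"
    proof (cases "p \<in> C")
      case True
      have "{m. x m \<in> W p} \<subseteq> {..<to_nat p}"
        using x(2)[OF True] by (force simp: not_le[symmetric])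
      then have "finite {m. x m \<in> W p}"
        by (rule finite_subset) simp
      then show ?thesis
        using W[OF True] U(1) by blast
    next
      case False
      have "{m. x m \<in> - C} = {}"
        using x(1) by blast
      then show ?thesis
        using assms(1) False by (intro exI[of _ "- C"]) auto
    qed
  qed
  then show thesis
    using that x(1) by blast
qed

text \<open>Taking the perturbation of \<open>x m\<close> from a late enough set of
  \<open>thin_family_perturbation\<close> keeps the sum in the open set \<open>V\<close>. Local
  finiteness survives because \<open>x m\<close> is recovered by adding the null sequence
  \<open>- y m\<close>.\<close>

lemma perturbed_sequence:
  fixes x :: "nat \<Rightarrow> 'a::topological_group_add"
  assumes "finite \<A>" "\<And>A. A \<in> \<A> \<Longrightarrow> \<not> thick A"
    and "open V" "\<And>m. x m \<in> V" and lf: "locally_finite_seq x"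
  shows "\<exists>y. y \<longlonglongrightarrow> 0 \<and> (\<forall>m. x m + y m \<in> V) \<and> (\<forall>m. x m + y m \<notin> \<Union>\<A>) \<and>
    locally_finite_seq (\<lambda>m. x m + y m)"
proof -
  obtain Y :: "nat \<Rightarrow> 'a set"
    where Y: "\<And>U. open U \<Longrightarrow> 0 \<in> U \<Longrightarrow> \<forall>\<^sub>F k in sequentially. Y k \<subseteq> U"
      "\<And>x k. \<exists>y\<in>Y k. x + y \<notin> \<Union>\<A>"
    using thin_family_perturbation[OF assms(1,2)] by metis
  have "\<exists>y k. m \<le> k \<and> y \<in> Y k \<and> x m + y \<in> V \<and> x m + y \<notin> \<Union>\<A>" for m
  proof -
    have "\<forall>\<^sub>F k in sequentially. Y k \<subseteq> {y. x m + y \<in> V}"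
      using open_left_translation[OF assms(3)] assms(4) by (intro Y(1)) auto
    then have "\<forall>\<^sub>F k in sequentially. m \<le> k \<and> Y k \<subseteq> {y. x m + y \<in> V}"
      using eventually_ge_at_top[of m] by eventually_elim simp
    then obtain k where k: "m \<le> k" "Y k \<subseteq> {y. x m + y \<in> V}"
      using eventually_happens'[OF sequentially_bot] by blast
    obtain y where "y \<in> Y k" "x m + y \<notin> \<Union>\<A>"
      using Y(2)[where x = "x m" and k = k] by auto
    then show ?thesis using k by (intro exI[of _ y] exI[of _ k]) auto
  qed
  then obtain y h where y: "\<And>m. m \<le> h m" "\<And>m. y m \<in> Y (h m)" "\<And>m. x m + y m \<in> V"
      "\<And>m. x m + y m \<notin> \<Union>\<A>"
    by metis
  have y0: "y \<longlonglongrightarrow> 0"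
  proof (rule topological_tendstoI)
    fix U :: "'a set" assume "open U" "0 \<in> U"
    from Y(1)[OF this] obtain k where k: "\<And>l. k \<le> l \<Longrightarrow> Y l \<subseteq> U"
      unfolding eventually_sequentially by blast
    have "y n \<in> U" if "k \<le> n" for n
      using k[OF order.trans[OF that y(1)]] y(2)[of n] by blast
    then show "\<forall>\<^sub>F n in sequentially. y n \<in> U"
      by (rule eventually_sequentiallyI)
  qed
  have "locally_finite_seq (\<lambda>m. x m + y m)"
    unfolding locally_finite_seq_def
  proof
    fix p
    obtain W where W: "open W" "p \<in> W" "finite {m. x m \<in> W}"
      using lf unfolding locally_finite_seq_def by blast
    then obtain W1 W2 where W12: "open W1" "p \<in> W1" "open W2" "0 \<in> W2"
        "\<And>v w. v \<in> W1 \<Longrightarrow> w \<in> W2 \<Longrightarrow> v + w \<in> W"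
      using open_add_split[of W p 0] by auto
    have "(\<lambda>m. - y m) \<longlonglongrightarrow> 0"
      using tendsto_minus[OF y0] by simp
    from topological_tendstoD[OF this W12(3,4)]
    obtain k where k: "\<And>m. k \<le> m \<Longrightarrow> - y m \<in> W2"
      unfolding eventually_sequentially by blast
    have "{m. x m + y m \<in> W1} \<subseteq> {m. x m \<in> W} \<union> {..<k}"
    proof
      fix m assume "m \<in> {m. x m + y m \<in> W1}"
      then have "x m \<in> W" if "k \<le> m"
        using W12(5)[OF _ k[OF that], of "x m + y m"] by (simp add: add.assoc)
      then show "m \<in> {m. x m \<in> W} \<union> {..<k}" by force
    qed
    then have "finite {m. x m + y m \<in> W1}"
      by (rule finite_subset) (use W(3) in simp)
    then show "\<exists>W. open W \<and> p \<in> W \<and> finite {m. x m + y m \<in> W}"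
      using W12(1,2) by (intro exI[of _ W1]) simp
  qed
  with y0 y(3,4) show ?thesis
    by (intro exI[of _ y] conjI allI)
qed

lemma thin_kernel_noncompact_network_False:
  fixes g :: "(nat \<Rightarrow> nat) \<Rightarrow> 'a::{topological_group_add, t3_space, countable} set"
    and \<N> :: "'a set set"
  assumes seq: "sequential_space (euclidean :: 'a topology)"
    and g: "\<And>\<alpha>. open (g \<alpha>)" "\<And>\<alpha>. 0 \<in> g \<alpha>"
    and cont: "\<And>\<alpha> x. \<exists>n. \<forall>\<beta>\<in>cyl \<alpha> n. x \<in> g \<beta> \<longleftrightarrow> x \<in> g \<alpha>"
    and K: "closed K" "K \<noteq> {}" "\<And>\<alpha> n. \<alpha> \<in> K \<Longrightarrow> \<not> thick (core g K \<alpha> n)"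
    and thin0: "\<not> thick {0 :: 'a}"
    and \<N>: "countable \<N>"
      "\<And>N V. N \<in> \<N> \<Longrightarrow> open V \<Longrightarrow> 0 \<in> V \<Longrightarrow> \<not> compact (closure (N \<inter> V))"
      "\<And>U. open U \<Longrightarrow> 0 \<in> U \<Longrightarrow> \<exists>N\<in>\<N>. N \<subseteq> U"
  shows False
proof -
  define N where "N = from_nat_into \<N>"
  have "\<N> \<noteq> {}" using \<N>(3)[of UNIV] by auto
  then have N: "range N = \<N>"
    unfolding N_def using \<N>(1) by (rule range_from_nat_into)
  define \<T> where "\<T> = {core g K \<alpha> n | \<alpha> n. \<alpha> \<in> K}"
  have "\<T> \<subseteq> (\<lambda>S. \<Inter>(g ` (K \<inter> S))) ` range (\<lambda>(\<alpha>, n). cyl \<alpha> n)"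
    unfolding \<T>_def core_def by auto
  then have "countable \<T>"
    using countable_cylinders by (meson countable_image countable_subset)
  moreover have "\<T> \<noteq> {}"
    using K(2) by (auto simp: \<T>_def)
  moreover define T where "T = from_nat_into \<T>"
  ultimately have T: "range T = \<T>"
    by (simp add: range_from_nat_into)
  \<comment> \<open>Including \<open>{0}\<close> keeps the perturbed points different from
    \<open>0\<close>; the set \<open>T i\<close> is avoided from row \<open>i\<close> on.\<close>
  define \<A> where "\<A> j = insert {0} (T ` {..j})" for j
  have A: "finite (\<A> j)" "\<And>A. A \<in> \<A> j \<Longrightarrow> \<not> thick A" for j
  proof -
    have "\<not> thick A" if "A \<in> \<T>" for A
      using that K(3) by (auto simp: \<T>_def)
    then show "\<And>A. A \<in> \<A> j \<Longrightarrow> \<not> thick A"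
      using thin0 T by (auto simp: \<A>_def)
  qed (simp add: \<A>_def)
  have "\<exists>O' W. open O' \<and> open W \<and> 0 \<in> W \<and> O' \<inter> W = {} \<and> (p \<noteq> 0 \<longrightarrow> p \<in> O')" for p :: 'a
  proof (cases "p = 0")
    case True
    then show ?thesis by (intro exI[of _ "{}"] exI[of _ UNIV]) simp
  next
    case False
    then show ?thesis using hausdorff[of p 0] by metis
  qed
  then obtain O' W :: "'a \<Rightarrow> 'a set" where OW: "\<And>p. open (O' p)" "\<And>p. open (W p)" "\<And>p. 0 \<in> W p"
      "\<And>p. O' p \<inter> W p = {}" "\<And>p. p \<noteq> 0 \<Longrightarrow> p \<in> O' p"
    by metis
  \<comment> \<open>\<open>V j\<close> is disjoint from the neighbourhood \<open>O' q\<close> of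
    \<open>q \<noteq> 0\<close> once \<open>j \<ge> to_nat q\<close>. So points from rows tending to
    infinity can converge only to \<open>0\<close>.\<close>
  define V where "V j = (\<Inter>i\<le>j. W (from_nat i))" for j :: nat
  have V: "open (V j)" "0 \<in> V j" for j
    unfolding V_def using OW by (auto intro: open_INT)
  define R where "R j x y \<longleftrightarrow> (\<forall>m. x m \<in> closure (N j)) \<and> y \<longlonglongrightarrow> 0 \<and> (\<forall>m. x m + y m \<in> V j) \<and>
      (\<forall>m. x m + y m \<notin> \<Union>(\<A> j)) \<and> locally_finite_seq (\<lambda>m. x m + y m)"
    for j and x y :: "nat \<Rightarrow> 'a"
  have ex: "\<exists>x y. R j x y" for j
  proof -
    obtain V' where V': "open V'" "0 \<in> V'" "closure V' \<subseteq> V j"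
      using regular_neighbourhood[OF V] .
    have "\<not> compact (closure (N j \<inter> V'))"
      using \<N>(2)[OF _ V'(1,2)] N by blast
    then obtain x where x: "\<And>m. x m \<in> closure (N j \<inter> V')" "locally_finite_seq x"
      using noncompact_locally_finite_seq[OF closed_closure] by blast
    have x1: "x m \<in> closure (N j)" for m
      using x(1)[of m] closure_mono[of "N j \<inter> V'" "N j"] by auto
    have xV: "x m \<in> V j" for m
      using x(1)[of m] closure_mono[of "N j \<inter> V'" V'] V'(3) by auto
    from perturbed_sequence[OF A(1)[of j] A(2)[of _ j] V(1) xV x(2)] x1
    show ?thesis unfolding R_def by - (rule exI[of _ x], simp)
  qed
  obtain x y where "\<And>j. R j (x j) (y j)"
    using ex by metis
  then have xy: "\<And>j m. x j m \<in> closure (N j)" "\<And>j. y j \<longlonglongrightarrow> 0"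
      "\<And>j m. x j m + y j m \<in> V j" "\<And>j m. x j m + y j m \<notin> \<Union>(\<A> j)"
      "\<And>j. locally_finite_seq (\<lambda>m. x j m + y j m)"
    unfolding R_def by blast+
  define z where "z j m = x j m + y j m" for j m
  define Z where "Z = {z j m | j m. True}"
  have "closed Z"
  proof (rule sequentially_closed_imp_closed[OF seq])
    fix s q assume s: "\<And>n. s n \<in> Z" "s \<longlonglongrightarrow> q"
    then have "\<forall>n. \<exists>j m. s n = z j m" by (auto simp: Z_def)
    then obtain J M where JM: "\<And>n. s n = z (J n) (M n)" by metis
    show "q \<in> Z"
    proof (rule ccontr)
      assume q: "q \<notin> Z"
      \<comment> \<open>Near \<open>q\<close> row \<open>j\<close> has only finitely many points,
        none equal to \<open>q\<close>; removing them leaves a neighbourhood of \<open>q\<close>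
        free of row \<open>j\<close>. Thus the row numbers \<open>J n\<close> tend to
        infinity.\<close>
      have fin: "\<forall>\<^sub>F n in sequentially. J n \<noteq> j" for j
      proof -
        obtain P where P: "open P" "q \<in> P" "finite {m. z j m \<in> P}"
          using xy(5)[of j] unfolding locally_finite_seq_def z_def by blast
        let ?F = "z j ` {m. z j m \<in> P}"
        have "open (P - ?F)" "q \<in> P - ?F"
          using P q by (auto simp: Z_def intro!: open_Diff finite_imp_closed)
        from topological_tendstoD[OF s(2) this]
        show ?thesis
        proof (rule eventually_mono)
          fix n assume "s n \<in> P - ?F"
          then show "J n \<noteq> j" using JM[of n] by auto
        qed
      qed
      have late: "\<forall>\<^sub>F n in sequentially. i \<le> J n" for i
      proof -
        have "\<forall>\<^sub>F n in sequentially. \<forall>j\<in>{..<i}. J n \<noteq> j"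
          using fin by (intro eventually_ball_finite) auto
        then show ?thesis
          by (rule eventually_mono) force
      qed
      show False
      proof (cases "q = 0")
        case False
        have "\<forall>\<^sub>F n in sequentially. s n \<in> O' q"
          using topological_tendstoD[OF s(2) OW(1)] OW(5)[OF False] by blast
        then have "\<forall>\<^sub>F n in sequentially. False"
          using late[of "to_nat q"]
        proof eventually_elim
          case (elim n)
          have "s n \<in> V (J n)" using xy(3) by (simp add: JM z_def)
          then have "s n \<in> W (from_nat (to_nat q))"
            using elim(2) unfolding V_def by blast
          then show False
            using elim(1) OW(4)[of q] by auto
        qed
        then show False by simp
      next
        case True
        have "\<forall>\<^sub>F i in sequentially. s i \<in> g \<alpha>" for \<alpha>
          using topological_tendstoD[OF s(2) g(1)] g(2) True by blast
        then obtain \<alpha> n where an: "\<alpha> \<in> K" "\<forall>\<^sub>F i in sequentially. s i \<in> core g K \<alpha> n"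
          using sequence_in_core[OF K(1,2) cont] by blast
        then have "core g K \<alpha> n \<in> \<T>"
          by (auto simp: \<T>_def)
        \<comment> \<open>The sequence is eventually inside this core, but the rows from
          \<open>i\<close> on avoid it.\<close>
        then obtain i where i: "core g K \<alpha> n = T i"
          using T by blast
        have "\<forall>\<^sub>F n in sequentially. False"
          using late[of i] an(2)
        proof eventually_elim
          case (elim n)
          then have "s n \<in> \<Union>(\<A> (J n))"
            unfolding i \<A>_def by blast
          then show False
            using xy(4) by (simp add: JM z_def)
        qed
        then show False by simp
      qed
    qed
  qed
  moreover have "0 \<notin> Z"
    using xy(4) unfolding Z_def z_def \<A>_def by force
  \<comment> \<open>Closedness of \<open>Z\<close> separates it from \<open>0 + 0\<close>. A row
    whose \<open>x j\<close> stays in \<open>V1\<close>, with an \<open>m\<close> for which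
    \<open>y j m\<close> is in \<open>V2\<close>, then gives a point of \<open>Z\<close> outside
    \<open>Z\<close>.\<close>
  ultimately obtain V1 V2 where V12: "open V1" "0 \<in> V1" "open V2" "0 \<in> V2"
      "\<And>v w. v \<in> V1 \<Longrightarrow> w \<in> V2 \<Longrightarrow> v + w \<in> - Z"
    using open_add_split[of "- Z" 0 0] by auto
  obtain V' where V': "open V'" "0 \<in> V'" "closure V' \<subseteq> V1"
    using regular_neighbourhood[OF V12(1,2)] .
  obtain j where "N j \<subseteq> V'"
    using \<N>(3)[OF V'(1,2)] N by blast
  then have "x j m \<in> V1" for m
    using xy(1)[of j m] closure_mono V'(3) by blast
  moreover have "\<forall>\<^sub>F m in sequentially. y j m \<in> V2"
    using topological_tendstoD[OF xy(2) V12(3,4)] .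
  then obtain m where "y j m \<in> V2"
    using eventually_happens'[OF sequentially_bot] by blast
  ultimately have "z j m \<in> - Z"
    using V12(5) by (simp add: z_def)
  then show False
    by (auto simp: Z_def)
qed

section \<open>Compact sets capturing null sequences, and the dichotomy\<close>

text \<open>The translates \<open>x + C\<close> are countably many compact sets. A sequence
  converging to \<open>x \<in> U\<close> is eventually in some \<open>x + C\<close>, and relative
  openness of \<open>U\<close> there puts its tail in \<open>U\<close>; \<open>0 \<in> C\<close>
  ensures that \<open>x\<close> itself lies in \<open>x + C\<close>.\<close>

lemma capturing_compacts_imp_k_omega:
  fixes \<C> :: "'a::{topological_group_add, t2_space, countable} set set"
  assumes seq: "sequential_space (euclidean :: 'a topology)"
    and "countable \<C>" "\<And>C. C \<in> \<C> \<Longrightarrow> compact C" "\<And>C. C \<in> \<C> \<Longrightarrow> 0 \<in> C"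
    and capt: "\<And>s. s \<longlonglongrightarrow> 0 \<Longrightarrow> \<exists>C\<in>\<C>. \<forall>\<^sub>F i in sequentially. s i \<in> C"
  shows "k_omega_space (euclidean :: 'a topology)"
proof -
  define \<K> where "\<K> = (\<lambda>(x, C). (+) x ` C) ` (UNIV \<times> \<C>)"
  have "\<C> \<noteq> {}"
    using capt[OF tendsto_const] by blast
  then have "\<K> \<noteq> {}" "countable \<K>"
    using assms(2) by (auto simp: \<K>_def)
  then obtain K :: "nat \<Rightarrow> 'a set" where K: "range K = \<K>"
    using range_from_nat_into by metis
  have comp: "compact (K n)" for n
  proof -
    have "K n \<in> \<K>"
      using K by blast
    then obtain x C where "C \<in> \<C>" "K n = (+) x ` C"
      by (auto simp: \<K>_def)
    then show ?thesis
      using assms(3) by (auto intro!: compact_continuous_image continuous_intros)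
  qed
  have "open U" if U: "\<And>n. openin (top_of_set (K n)) (U \<inter> K n)" for U
  proof (rule sequentially_open_imp_open[OF seq])
    fix s x assume x: "x \<in> U" "s \<longlonglongrightarrow> x"
    obtain C where C: "C \<in> \<C>" "\<forall>\<^sub>F i in sequentially. - x + s i \<in> C"
      using capt[OF tendsto_zero_left_translation[OF x(2)]] by blast
    then have "(+) x ` C \<in> range K"
      unfolding K \<K>_def by auto
    then obtain n where n: "K n = (+) x ` C" by auto
    obtain T where T: "open T" "U \<inter> K n = K n \<inter> T"
      using U[of n] by (auto simp: openin_open)
    have "x \<in> K n"
      unfolding n using assms(4)[OF C(1)] by (force intro: image_eqI[of _ _ 0])
    then have "x \<in> T" using T(2) x(1) by blast
    from topological_tendstoD[OF x(2) T(1) this] C(2)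
    show "\<forall>\<^sub>F i in sequentially. s i \<in> U"
    proof eventually_elim
      case (elim i)
      then have "s i \<in> K n"
        unfolding n by (intro image_eqI[of _ _ "- x + s i"]) (simp_all add: add.assoc[symmetric])
      then show "s i \<in> U" using elim(1) T(2) by blast
    qed
  qed
  moreover have "openin (top_of_set (K n)) (U \<inter> K n)" if "open U" for U n
    using that by (auto simp: openin_open)
  ultimately show ?thesis
    unfolding k_omega_space_def using comp by (intro exI[of _ K]) auto
qed

lemma analytic_imp_first_countable_or_k_omega:
  assumes seq: "sequential_space (euclidean :: 'a::{topological_group_add, t3_space, countable} topology)"
    and "analytic_topology (euclidean :: 'a topology)"
  shows "first_countable (euclidean :: 'a topology) \<or> k_omega_space (euclidean :: 'a topology)"
proof (cases "first_countable (euclidean :: 'a topology)")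
  case False
  obtain f :: "(nat \<Rightarrow> nat) \<Rightarrow> 'a \<Rightarrow> bool"
    where f: "continuous_on UNIV f" "range f = {c. open {x. c x}}"
    using assms(2) by (auto simp: analytic_topology_def analytic_set_def open_set_indicators_def)
  \<comment> \<open>The values of \<open>f\<close> are all open sets; those missing \<open>0\<close>
    are replaced by the whole space. Whether \<open>0\<close> is present is decided on a cylinder,
    so \<open>g\<close> stays continuous.\<close>
  define g where "g \<alpha> = (if f \<alpha> 0 then {x. f \<alpha> x} else UNIV)" for \<alpha>
  have g: "open (g \<alpha>)" "0 \<in> g \<alpha>" for \<alpha>
    using f(2) by (auto simp: g_def)
  have onto: "\<exists>\<alpha>. g \<alpha> = U" if "open U" "0 \<in> U" for U
  proof -
    have "(\<lambda>x. x \<in> U) \<in> range f"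
      using that(1) f(2) by simp
    then obtain \<alpha> where "f \<alpha> = (\<lambda>x. x \<in> U)" by auto
    then show ?thesis
      using that(2) by (intro exI[of _ \<alpha>]) (simp add: g_def)
  qed
  have cont: "\<exists>n. \<forall>\<beta>\<in>cyl \<alpha> n. x \<in> g \<beta> \<longleftrightarrow> x \<in> g \<alpha>" for \<alpha> x
  proof -
    obtain n where n: "\<forall>\<beta>\<in>cyl \<alpha> n. f \<beta> 0 = f \<alpha> 0"
      using f(1) unfolding continuous_Baire_iff by blast
    obtain m where m: "\<forall>\<beta>\<in>cyl \<alpha> m. f \<beta> x = f \<alpha> x"
      using f(1) unfolding continuous_Baire_iff by blast
    have "x \<in> g \<beta> \<longleftrightarrow> x \<in> g \<alpha>" if "\<beta> \<in> cyl \<alpha> (max n m)" for \<beta>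
    proof -
      have "\<beta> \<in> cyl \<alpha> n" "\<beta> \<in> cyl \<alpha> m"
        using that cyl_mono[of n "max n m" \<alpha>] cyl_mono[of m "max n m" \<alpha>] by auto
      then have "f \<beta> 0 = f \<alpha> 0" "f \<beta> x = f \<alpha> x"
        using n m by blast+
      then show ?thesis by (simp add: g_def)
    qed
    then show ?thesis by blast
  qed
  have network: "\<exists>N\<in>\<N>. N \<subseteq> U" if "\<And>\<alpha>. \<exists>N\<in>\<N>. N \<subseteq> g \<alpha>" "open U" "0 \<in> U" for \<N> U
    using that(1) onto[OF that(2,3)] by metis
  \<comment> \<open>If \<open>{0}\<close> were thick, it would alone form a thick network, since it
    lies inside every neighbourhood of \<open>0\<close>; that would give first countability.\<close>
  have thin0: "\<not> thick {0 :: 'a}"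
    using thick_network_imp_first_countable[OF seq, of "{{0}}"] False by auto
  obtain K where K: "closed K" "K \<noteq> {}" "\<And>\<alpha> n. \<alpha> \<in> K \<Longrightarrow> \<not> thick (core g K \<alpha> n)"
  proof (rule kernel_dichotomy[of thick g])
    fix \<N> :: "'a set set"
    assume n: "countable \<N>" "\<And>N. N \<in> \<N> \<Longrightarrow> thick N" "\<And>\<alpha>. \<exists>N\<in>\<N>. N \<subseteq> g \<alpha>"
    have "first_countable (euclidean :: 'a topology)"
      by (rule thick_network_imp_first_countable[OF seq n(1,2) network[OF n(3)]])
    with False show thesis by contradiction
  next
    fix K
    assume "closed K" "K \<noteq> {}" "\<And>\<alpha> n. \<alpha> \<in> K \<Longrightarrow> \<not> thick (core g K \<alpha> n)"
    then show thesis by (rule that)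
  qed
  \<comment> \<open>On the second kernel \<open>?P\<close> fails, so each core has compact closure
    after intersection with a suitable neighbourhood of \<open>0\<close>. These closures will
    capture the null sequences.\<close>
  let ?P = "\<lambda>N :: 'a set. \<forall>V. open V \<and> 0 \<in> V \<longrightarrow> \<not> compact (closure (N \<inter> V))"
  obtain L where L: "closed L" "L \<noteq> {}" "\<And>\<alpha> n. \<alpha> \<in> L \<Longrightarrow> \<not> ?P (core g L \<alpha> n)"
  proof (rule kernel_dichotomy[of ?P g])
    fix \<N> :: "'a set set"
    assume n: "countable \<N>" "\<And>N. N \<in> \<N> \<Longrightarrow> ?P N" "\<And>\<alpha>. \<exists>N\<in>\<N>. N \<subseteq> g \<alpha>"
    have "False"
      by (rule thin_kernel_noncompact_network_False[OF seq g cont K thin0 n(1) _ network[OF n(3)]])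
        (use n(2) in auto)
    then show thesis ..
  next
    fix L
    assume "closed L" "L \<noteq> {}" "\<And>\<alpha> n. \<alpha> \<in> L \<Longrightarrow> \<not> ?P (core g L \<alpha> n)"
    then show thesis by (rule that)
  qed
  define \<T> where "\<T> = {core g L \<alpha> n | \<alpha> n. \<alpha> \<in> L}"
  have "\<T> \<subseteq> (\<lambda>S. \<Inter>(g ` (L \<inter> S))) ` range (\<lambda>(\<alpha>, n). cyl \<alpha> n)"
    unfolding \<T>_def core_def by auto
  then have "countable \<T>"
    using countable_cylinders by (meson countable_image countable_subset)
  have "\<forall>N\<in>\<T>. \<exists>V. open V \<and> 0 \<in> V \<and> compact (closure (N \<inter> V))"
    using L(3) by (auto simp: \<T>_def)
  then obtain V where V: "\<And>N. N \<in> \<T> \<Longrightarrow> open (V N) \<and> 0 \<in> V N \<and> compact (closure (N \<inter> V N))"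
    by metis
  have "k_omega_space (euclidean :: 'a topology)"
  proof (rule capturing_compacts_imp_k_omega[OF seq])
    show "countable ((\<lambda>N. closure (N \<inter> V N)) ` \<T>)"
      using \<open>countable \<T>\<close> by simp
    show "compact C" if "C \<in> (\<lambda>N. closure (N \<inter> V N)) ` \<T>" for C
      using that V by auto
    show "0 \<in> C" if C: "C \<in> (\<lambda>N. closure (N \<inter> V N)) ` \<T>" for C
    proof -
      obtain N where N: "N \<in> \<T>" "C = closure (N \<inter> V N)"
        using C by blast
      then have "0 \<in> N \<inter> V N"
        using V g(2) by (auto simp: \<T>_def core_def)
      then show ?thesis
        unfolding N(2) using closure_subset[of "N \<inter> V N"] by (rule subsetD[rotated])
    qed
    fix s :: "nat \<Rightarrow> 'a" assume s: "s \<longlonglongrightarrow> 0"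
    have "\<forall>\<^sub>F i in sequentially. s i \<in> g \<alpha>" for \<alpha>
      using topological_tendstoD[OF s g(1,2)] .
    then obtain \<alpha> n where an: "\<alpha> \<in> L" "\<forall>\<^sub>F i in sequentially. s i \<in> core g L \<alpha> n"
      using sequence_in_core[OF L(1,2) cont] by blast
    let ?N = "core g L \<alpha> n"
    have N: "?N \<in> \<T>"
      using an(1) by (auto simp: \<T>_def)
    then have "\<forall>\<^sub>F i in sequentially. s i \<in> V ?N"
      using V by (intro topological_tendstoD[OF s]) auto
    with an(2) have "\<forall>\<^sub>F i in sequentially. s i \<in> closure (?N \<inter> V ?N)"
    proof eventually_elim
      case (elim i)
      then show ?case using closure_subset[of "?N \<inter> V ?N"] by blast
    qed
    then show "\<exists>C\<in>(\<lambda>N. closure (N \<inter> V N)) ` \<T>. \<forall>\<^sub>F i in sequentially. s i \<in> C"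
      using N by blast
  qed
  then show ?thesis ..
qed simp

theorem theorem1:
  assumes "sequential_space (euclidean :: 'a::{topological_group_add, t3_space, countable} topology)"
  shows "(analytic_topology (euclidean :: 'a topology) \<longleftrightarrow>
            fsigma_delta_topology (euclidean :: 'a topology)) \<and>
         (fsigma_delta_topology (euclidean :: 'a topology) \<longleftrightarrow>
            first_countable (euclidean :: 'a topology) \<or> k_omega_space (euclidean :: 'a topology))"
proof -
  \<comment> \<open>The empty set is open, so the set of indicators is nonempty, as
    \<open>fsigma_delta_imp_analytic\<close> requires.\<close>
  have "(\<lambda>_. False) \<in> open_set_indicators (euclidean :: 'a topology)"
    by (simp add: open_set_indicators_def)
  then have "analytic_topology (euclidean :: 'a topology)"
    if "fsigma_delta_topology (euclidean :: 'a topology)"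
    using that fsigma_delta_imp_analytic unfolding analytic_topology_def fsigma_delta_topology_def
    by blast
  then show ?thesis
    using analytic_imp_first_countable_or_k_omega[OF assms]
      first_countable_imp_fsigma_delta[where 'a = 'a] k_omega_imp_fsigma_delta[where 'a = 'a]
    by blast
qed

end
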